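(* Let $n$ and $d$ be positive integers with $d\geqslant 3$ and $n\equiv \pm 1\pmod{d}$, and let $a$ be an indeterminate. Then \[ \sum_{k=0}^{n-1} [2dk+1]\frac{(aq,q/a;q^d)_k\, (q;q^d)_k^4} {(aq^d,q^d/a;q^d)_k\, (q^d;q^d)_k^4}\, q^{(2d-3)k} \equiv \begin{cases} 0 \pmod{\Phi_n(q)}, &\text{if } n\equiv 1\pmod d,\\ 0 \pmod{\Phi_n(q)^2}, &\text{if } n\equiv -1\pmod d. \end{cases} \]
   Context: Here $q$ and $a$ are indeterminates. For $x$ and a base $p$ (a power of $q$), $(x;p)_k=\prod_{j=0}^{k-1}(1-xp^j)$ and $(x_1,\dots,x_m;p)_k=(x_1;p)_k\cdots(x_m;p)_k$. The $q$-integer is $[m]=1+q+\cdots+q^{m-1}$ and $\Phi_n(q)$ is the $n$-th cyclotomic polynomial. For rational functions $A,B$ in $q,a$ and a polynomial $P$, $A\equiv B\pmod{P}$ means that the numerator of the reduced form of $A-B$ is divisible by $P$ in the polynomial ring over $\mathbb{Z}$ in these variables.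
   Formalization: The formal theorem assumes n > 1: for n = 1 (which satisfies n ≡ 1 mod d) the sum equals 1, which is not divisible by Φ_1(q) = q − 1, so the stated congruence fails there; no other case is excluded. *)

theory Defs
  imports
    Complex_Main
    "HOL-Computational_Algebra.Computational_Algebra"
    "HOL-Number_Theory.Cong"
begin

subsection \<open>\<open>q\<close>-integers and \<open>q\<close>-shifted factorials\<close>

definition q_int :: "'a::comm_ring_1 \<Rightarrow> nat \<Rightarrow> 'a" where
  "q_int q m = (\<Sum>i<m. q ^ i)"

definition qpoch :: "'a::comm_ring_1 \<Rightarrow> 'a \<Rightarrow> nat \<Rightarrow> 'a" where
  "qpoch x p k = (\<Prod>j<k. 1 - x * p ^ j)"

definition qpochs :: "'a::comm_ring_1 list \<Rightarrow> 'a \<Rightarrow> nat \<Rightarrow> 'a" where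
  "qpochs xs p k = (\<Prod>x\<leftarrow>xs. qpoch x p k)"

subsection \<open>Cyclotomic polynomials\<close>

definition primitive_roots_unity :: "nat \<Rightarrow> complex set" where
  "primitive_roots_unity n = {z. z ^ n = 1 \<and> (\<forall>m\<in>{1..<n}. z ^ m \<noteq> 1)}"

text \<open>The definition is meaningful for \<open>n > 0\<close> only; see \<open>cyclotomic_spec\<close> below.\<close>

definition cyclotomic :: "nat \<Rightarrow> int poly" where
  "cyclotomic n =
     (THE p. map_poly of_int p = (\<Prod>z\<in>primitive_roots_unity n. [:- z, 1:]))"

subsection \<open>Rational functions in \<open>q\<close> and \<open>a\<close>\<close>

text \<open>
  \<open>\<int>[q, a]\<close> is the type \<^typ>\<open>int poly poly\<close>, with \<open>q\<close> the inner and \<open>a\<close> the outer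
  variable. Its fraction field is the field of rational functions in \<open>q\<close> and \<open>a\<close>.
\<close>

definition ratfun_q :: "int poly poly fract" where
  "ratfun_q = to_fract [:[:0, 1:]:]"

definition ratfun_a :: "int poly poly fract" where
  "ratfun_a = to_fract [:0, 1:]"

text \<open>\<^const>\<open>quot_of_fract\<close> yields the pair (numerator, denominator) of the reduced form.\<close>

definition ratfun_cong ::
    "int poly poly fract \<Rightarrow> int poly poly fract \<Rightarrow> int poly poly \<Rightarrow> bool" where
  "ratfun_cong A B P \<longleftrightarrow> P dvd fst (quot_of_fract (A - B))"

subsection \<open>Existence of the cyclotomic polynomials\<close>

lemma finite_primitive_roots_unity: "n > 0 \<Longrightarrow> finite (primitive_roots_unity n)"
  by (rule finite_subset[OF _ finite_roots_unity[of n]]) (auto simp: primitive_roots_unity_def)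

lemma roots_unity_eq_UN_primitive:
  assumes "n > 0"
  shows "{z::complex. z ^ n = 1} = (\<Union>d\<in>{d. d dvd n}. primitive_roots_unity d)"
proof (intro equalityI subsetI)
  fix z :: complex assume "z \<in> {z. z ^ n = 1}"
  hence z: "z ^ n = 1" by simp
  define d where "d = (LEAST d. d > 0 \<and> z ^ d = 1)"
  have d: "d > 0 \<and> z ^ d = 1"
    unfolding d_def by (rule LeastI[of _ n]) (use z assms in auto)
  have least: "z ^ m \<noteq> 1" if "m > 0" "m < d" for m
    using not_less_Least[of m "\<lambda>d. d > 0 \<and> z ^ d = 1"] that unfolding d_def by blast
  have "z ^ (n mod d) = 1"
  proof -
    have "1 = z ^ (d * (n div d) + n mod d)" using z by simp
    also have "\<dots> = z ^ (n mod d)" using d by (simp only: power_add power_mult) simp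
    finally show ?thesis by simp
  qed
  hence "n mod d = 0" using least[of "n mod d"] d by (cases "n mod d = 0") auto
  hence "d dvd n" by auto
  moreover have "z \<in> primitive_roots_unity d"
    using d least by (auto simp: primitive_roots_unity_def)
  ultimately show "z \<in> (\<Union>d\<in>{d. d dvd n}. primitive_roots_unity d)" by blast
next
  fix z :: complex assume "z \<in> (\<Union>d\<in>{d. d dvd n}. primitive_roots_unity d)"
  thus "z \<in> {z. z ^ n = 1}"
    by (auto simp: primitive_roots_unity_def power_mult elim!: dvdE)
qed

lemma primitive_roots_unity_disjoint:
  assumes "c > 0" "d > 0" "c \<noteq> d"
  shows "primitive_roots_unity c \<inter> primitive_roots_unity d = {}"
proof (cases "c < d")
  case True
  hence "c \<in> {1..<d}" using assms by auto
  thus ?thesis by (auto simp: primitive_roots_unity_def)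
next
  case False
  hence "d \<in> {1..<c}" using assms by auto
  thus ?thesis by (auto simp: primitive_roots_unity_def)
qed

lemma prod_roots_unity:
  assumes "n > 0"
  shows "(\<Prod>z | z ^ n = 1. [:- z, 1:]) = (monom 1 n - 1 :: complex poly)"
proof -
  let ?p = "monom 1 n - 1 :: complex poly"
  have deg: "degree ?p = n"
    using degree_add_eq_left[of "-1" "monom (1::complex) n"] assms by (simp add: degree_monom_eq)
  have lc: "lead_coeff ?p = 1"
    using assms unfolding deg by simp
  have "rsquarefree ?p"
    unfolding rsquarefree_roots
    using assms by (auto simp: pderiv_diff pderiv_monom poly_monom power_0_left)
  from complex_poly_decompose_rsquarefree[OF this] show ?thesis
    unfolding lc by (simp add: poly_monom)
qed

lemma map_poly_of_int_diff:
  "map_poly of_int (p - q) = (map_poly of_int p - map_poly of_int q :: complex poly)"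
  by (rule poly_eqI) (simp add: coeff_map_poly)

lemma map_poly_of_int_add:
  "map_poly of_int (p + q) = (map_poly of_int p + map_poly of_int q :: complex poly)"
  by (rule poly_eqI) (simp add: coeff_map_poly)

lemma map_poly_of_int_mult:
  "map_poly of_int (p * q) = (map_poly of_int p * map_poly of_int q :: complex poly)"
  by (rule poly_eqI) (simp add: coeff_map_poly coeff_mult)

lemma map_poly_of_int_prod:
  "map_poly of_int (prod f A) = (\<Prod>x\<in>A. map_poly of_int (f x) :: complex poly)"
  by (induction A rule: infinite_finite_induct) (simp_all add: map_poly_of_int_mult)

lemma map_poly_of_int_eq_iff:
  "map_poly of_int p = (map_poly of_int q :: complex poly) \<longleftrightarrow> p = q"
  by (auto simp: poly_eq_iff coeff_map_poly)

lemma cyclotomic_exists: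
  assumes "n > 0"
  shows "\<exists>p. map_poly of_int p = (\<Prod>z\<in>primitive_roots_unity n. [:- z, 1:])"
  using assms
proof (induction n rule: less_induct)
  case (less n)
  define C :: "nat \<Rightarrow> complex poly" where "C d = (\<Prod>z\<in>primitive_roots_unity d. [:- z, 1:])" for d
  define D where "D = {d. d dvd n} - {n}"
  have D: "d > 0" "d < n" if "d \<in> D" for d
    using that less.prems by (auto simp: D_def dest: dvd_imp_le intro!: Nat.gr0I)
  have fin: "finite D" using less.prems by (simp add: D_def)
  have lcC: "lead_coeff (C d) = 1" for d
    by (simp add: C_def lead_coeff_prod)
  have "\<forall>d\<in>D. \<exists>p. map_poly of_int p = C d"
    using less.IH D unfolding C_def by blast
  then obtain P where P: "\<And>d. d \<in> D \<Longrightarrow> map_poly of_int (P d) = C d" by metis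
  define B where "B = (\<Prod>d\<in>D. P d)"
  have B: "map_poly of_int B = (\<Prod>d\<in>D. C d)"
    unfolding B_def map_poly_of_int_prod using P by simp
  have degB: "degree (map_poly of_int p :: complex poly) = degree p" for p
    by (rule degree_map_poly) auto
  have "of_int (lead_coeff B) = lead_coeff (map_poly of_int B :: complex poly)"
    unfolding degB by (simp add: coeff_map_poly)
  also have "\<dots> = 1" unfolding B by (simp add: lead_coeff_prod lcC)
  finally have lcB: "lead_coeff B = 1" by (metis of_int_eq_1_iff)
  hence B0: "B \<noteq> 0" by auto
  have split: "monom 1 n - 1 = map_poly of_int B * C n"
  proof -
    have "(monom 1 n - 1 :: complex poly) = (\<Prod>z | z ^ n = 1. [:- z, 1:])"
      using prod_roots_unity[OF less.prems] by simp
    also have "\<dots> = (\<Prod>d\<in>{d. d dvd n}. C d)"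
      unfolding roots_unity_eq_UN_primitive[OF less.prems] C_def
    proof (rule prod.UNION_disjoint)
      show "finite {d. d dvd n}" using less.prems by simp
      have pos: "d > 0" if "d dvd n" for d using that less.prems by (auto intro!: Nat.gr0I)
      show "\<forall>d\<in>{d. d dvd n}. finite (primitive_roots_unity d)"
        using finite_primitive_roots_unity pos by auto
      show "\<forall>i\<in>{d. d dvd n}. \<forall>j\<in>{d. d dvd n}.
          i \<noteq> j \<longrightarrow> primitive_roots_unity i \<inter> primitive_roots_unity j = {}"
        using primitive_roots_unity_disjoint pos by simp
    qed
    also have "{d. d dvd n} = insert n D" by (auto simp: D_def)
    also have "(\<Prod>d\<in>\<dots>. C d) = C n * (\<Prod>d\<in>D. C d)"
      using fin by (subst prod.insert) (auto simp: D_def)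
    finally show ?thesis by (simp add: B mult.commute)
  qed
  obtain Q R where QR: "pseudo_divmod (monom 1 n - 1) B = (Q, R)" by force
  from pseudo_divmod[OF B0 QR] have QR': "monom 1 n - 1 = B * Q + R"
      and R: "R = 0 \<or> degree R < degree B"
    by (simp_all add: lcB)
  have one: "map_poly of_int (monom 1 n - 1) = (monom 1 n - 1 :: complex poly)"
    by (simp add: map_poly_of_int_diff map_poly_monom)
  have eq: "map_poly of_int B * (C n - map_poly of_int Q) = map_poly of_int R"
    using split one unfolding QR' map_poly_of_int_add map_poly_of_int_mult
    by (simp add: algebra_simps)
  have "C n - map_poly of_int Q = 0"
  proof (rule ccontr)
    assume nz: "C n - map_poly of_int Q \<noteq> 0"
    have B0': "(map_poly of_int B :: complex poly) \<noteq> 0"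
      using B0 map_poly_of_int_eq_iff[of B 0] by simp
    hence "map_poly of_int R \<noteq> (0 :: complex poly)" using nz eq by force
    hence "R \<noteq> 0" by auto
    hence "degree R < degree B" using R by blast
    moreover have "degree R = degree B + degree (C n - map_poly of_int Q)"
      using degree_mult_eq[OF B0' nz] unfolding eq degB by simp
    ultimately show False by simp
  qed
  thus ?case unfolding C_def by (intro exI[of _ Q]) simp
qed

lemma cyclotomic_spec:
  assumes "n > 0"
  shows "map_poly of_int (cyclotomic n) = (\<Prod>z\<in>primitive_roots_unity n. [:- z, 1:])"
proof -
  have "\<exists>!p. map_poly of_int p = (\<Prod>z\<in>primitive_roots_unity n. [:- z, 1:])"
    using cyclotomic_exists[OF assms] map_poly_of_int_eq_iff by metis
  thus ?thesis unfolding cyclotomic_def by (rule theI')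
qed

text \<open>
  For \<open>n = 1\<close> a sum over \<open>0 \<le> k \<le> n - 1\<close> whose summand at \<open>k = 0\<close> is \<open>1\<close> equals \<open>1\<close>,
  which is not divisible by \<open>\<Phi>\<^sub>1(q) = q - 1\<close>. Hence the congruences are considered for
  \<open>n > 1\<close> only.
\<close>

lemma cyclotomic_1: "cyclotomic 1 = [:- 1, 1:]"
proof -
  have "primitive_roots_unity 1 = {1}" by (auto simp: primitive_roots_unity_def)
  hence "map_poly of_int (cyclotomic 1) = (map_poly of_int [:- 1, 1:] :: complex poly)"
    using cyclotomic_spec[of 1] by (simp add: map_poly_pCons)
  thus ?thesis by (simp only: map_poly_of_int_eq_iff)
qed

lemma not_ratfun_cong_1_0_cyclotomic_1: "\<not> ratfun_cong 1 0 [:cyclotomic 1:]"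
proof
  assume "ratfun_cong 1 0 [:cyclotomic 1:]"
  hence "[:cyclotomic 1:] dvd 1" by (simp add: ratfun_cong_def)
  hence "[:- 1, 1 :: int:] dvd 1"
    by (simp only: cyclotomic_1 is_unit_const_poly_iff)
  thus False by (auto simp: is_unit_poly_iff)
qed

end

(* Multiply the sum by 1 - q and put p = q^d. Choose N < n with 1 + d N = t n, where t = 1 if
   n = 1 (mod d) and t = d - 1 if n = -1 (mod d), and let x = q^(t n) = q p^N, so that
   x = 1 (mod Phi_n). Replacing (q;p)_k^2 / (p;p)_k^2 by (qx, q/x;p)_k / (px, p/x;p)_k changes
   nothing modulo Phi_n^2. Since q/x = p^(-N), the new sum is a terminating very-well-poised
   8phi7, which Watson's transformation turns into a sum of terms with numerator
   (q;p)_{N+1} (p/q;p)_j (p/(qx);p)_{N-j} and denominators coprime to Phi_n. The first factor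
   contains 1 - q^(t n). If n + 1 = d M, then (p/q;p)_j for j >= M contains 1 - q^n and
   (p/(qx);p)_{N-j} for N - j >= M contains 1 - q^(n - t n); as 3 M <= n + 1, one of the two
   always applies. *)

theory Submission
  imports Defs
begin

subsection \<open>Watson's transformation\<close>

text \<open>Since (1 - q) [2dk + 1] = 1 - q p^(2k), the extra factor produces the very-well-poised
  factor for A = q; it can be divided out afterwards because n > 1 makes 1 - q a unit modulo Phi_n.
  Besides A, Watson's parameters are aq, q/a, q, qx and q/x = p^(-N). They force the argument
  p^2/q^3, which is where the exponent 2d - 3 comes from. Two of the four copies of (q;p)_k serve as
  A and as the plain parameter q, so one pair is left to carry x. The price of the deformation is (1
  - x)^2, hence the method reaches Phi_n^2 and no further power. The delicate point is that every
  denominator must be coprime to Phi_n. Those without a are shifted factorials of p, px and p/x of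
  length below n; their exponents are multiples of d up to multiples of n, and n is coprime to d.
  Those with a are harmless because a is an indeterminate: 1 - a q^m has a coefficient 1 as a
  polynomial in a.\<close>

lemma qpoch_0 [simp]: "qpoch x p 0 = 1"
  by (simp add: qpoch_def)

lemma qpoch_Suc: "qpoch x p (Suc k) = qpoch x p k * (1 - x * p ^ k)"
  by (simp add: qpoch_def)

lemma qpoch_add: "qpoch x p (m + k) = qpoch x p m * qpoch (x * p ^ m) p k"
  by (induction k) (simp_all add: qpoch_Suc power_add mult_ac)

lemma qpoch_Suc_left: "qpoch x p (Suc k) = (1 - x) * qpoch (x * p) p k"
  using qpoch_add[of x p 1 k] by (simp add: qpoch_Suc)

lemma qpoch_nonzero:
  fixes x p :: "'a::field"
  assumes "\<And>i. i < k \<Longrightarrow> x * p ^ i \<noteq> 1"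
  shows "qpoch x p k \<noteq> 0"
  using assms by (simp add: qpoch_def)

text \<open>The factor of index k is 1 - p^(-k) p^k. This ends every terminating sum and kills every
  upper boundary term below.\<close>

lemma qpoch_inverse_power_eq_0:
  fixes p :: "'a::field"
  assumes "p \<noteq> 0" "k < m"
  shows "qpoch (inverse p ^ k) p m = 0"
  using assms by (auto simp: qpoch_def power_inverse intro!: bexI[of _ k])

text \<open>
  The polynomial identity behind the WZ certificate of the \<open>q\<close>-Pfaff--Saalschuetz sum, where
  \<open>u = p ^ k\<close> and \<open>v = p ^ j\<close>. Here and below the constraints \<open>A * p = f * b * c\<close> and
  \<open>A * p = g * d * e\<close> replace the usual abbreviations \<open>f = A p / (b c)\<close>, \<open>g = A p / (d e)\<close>, so that
  \<open>A p / b = f c\<close> etc. and fewer divisions occur.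
\<close>

lemma saal_identity:
  fixes p u v f b c A :: "'a::field"
  assumes "p \<noteq> 0" "u \<noteq> 0" and A: "A * p = f * b * c"
  shows "v * ((1 - f * c * u) * (1 - f * b * u) * (1 - inverse (p * u)) * (1 - A * u * v)
      - f * (1 - b * u) * (1 - c * u) * (1 - v * inverse (p * u)) * (1 - A * u))
    = (1 - A * p * u ^ 2) * ((1 - v * inverse (p * u)) * (1 - A * u * v) * (1 - f * v)
      - (1 - v) * (1 - f * c * v * inverse p) * (1 - f * b * v * inverse p))"
proof -
  have A': "A = f * b * c / p" using assms by (simp add: field_simps)
  show ?thesis using assms(1,2) unfolding A'
    by (simp add: divide_simps) (simp add: algebra_simps power2_eq_square)
qed

text \<open>The polynomial identity behind the WZ certificate of \<open>terminating_sixphi5\<close>,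
  where \<open>U = p ^ N\<close> and \<open>v = p ^ k\<close>.\<close>

lemma sixphi5_identity:
  fixes p U v f d e A :: "'a::field"
  assumes "p \<noteq> 0" "U \<noteq> 0" and A: "A * p = f * d * e"
  shows "(1 - A * v ^ 2) * ((1 - f * e * U) * (1 - f * d * U) * (1 - inverse (p * U)) * v
      - (1 - f * U) * (1 - v * inverse (p * U)) * (1 - A * p * U * v))
    = (1 - A * v) * (1 - d * v) * (1 - e * v) * (1 - v * inverse (p * U)) * (f * U)
      - (1 - v) * (1 - f * e * v * inverse p) * (1 - f * d * v * inverse p) * (1 - A * p * U * v)"
proof -
  have A': "A = f * d * e / p" using assms by (simp add: field_simps)
  show ?thesis using assms(1,2) unfolding A'
    by (simp add: divide_simps) (simp add: algebra_simps power2_eq_square)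
qed

section \<open>Telescoping proofs of the two summation formulas\<close>

lemma saal_telescope:
  fixes p f b c A :: "'a::field"
  assumes p: "p \<noteq> 0" and A: "A * p = f * b * c"
    and nz: "\<And>i. p * p ^ i \<noteq> 1" "\<And>i. f * c * p ^ i \<noteq> 1" "\<And>i. f * b * p ^ i \<noteq> 1"
  defines "s \<equiv> \<lambda>k j. qpoch (inverse p ^ k) p j * qpoch (A * p ^ k) p j * qpoch f p j * p ^ j
      / (qpoch p p j * qpoch (f * c) p j * qpoch (f * b) p j)"
    and "g \<equiv> \<lambda>k j. case j of 0 \<Rightarrow> 0 | Suc i \<Rightarrow> (1 - A * p * (p ^ k) ^ 2)
      * (qpoch (inverse p ^ k) p i * qpoch (A * p ^ Suc k) p i * qpoch f p (Suc i)
      / (qpoch p p i * qpoch (f * c) p i * qpoch (f * b) p i))"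
  shows "(1 - f * c * p ^ k) * (1 - f * b * p ^ k) * s (Suc k) j
      - f * (1 - b * p ^ k) * (1 - c * p ^ k) * s k j = g k (Suc j) - g k j"
proof (cases j)
  case 0
  have "(1 - f * c * p ^ k) * (1 - f * b * p ^ k) - f * (1 - b * p ^ k) * (1 - c * p ^ k)
      = (1 - f * b * c * (p ^ k) ^ 2) * (1 - f)"
    by (simp add: algebra_simps power2_eq_square)
  thus ?thesis using 0 A by (simp add: s_def g_def qpoch_Suc)
next
  case (Suc i)
  define u v where "u = p ^ k" and "v = p ^ j"
  \<comment> \<open>\<open>X\<close> is the common factor of all four terms. The two products whose
    base depends on k get length i = j - 1, since passing from k to k + 1 shifts them by one
    factor.\<close>
  define X where "X = qpoch (inverse p ^ k) p i * qpoch (A * p ^ Suc k) p i * qpoch f p j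
      / (qpoch p p j * qpoch (f * c) p j * qpoch (f * b) p j)"
  have v: "v = p ^ i * p" by (simp add: v_def Suc)
  have u0: "u \<noteq> 0" using p by (simp add: u_def)
  have s1: "s (Suc k) j = X * v * ((1 - inverse (p * u)) * (1 - A * u * v))"
  proof -
    have "qpoch (inverse p ^ Suc k) p j = (1 - inverse (p * u)) * qpoch (inverse p ^ k) p i"
      using p by (simp add: Suc qpoch_Suc_left u_def power_inverse field_simps)
    moreover have "qpoch (A * p ^ Suc k) p j = qpoch (A * p ^ Suc k) p i * (1 - A * u * v)"
      by (simp add: Suc qpoch_Suc u_def v_def mult_ac)
    ultimately show ?thesis by (simp add: s_def X_def v_def)
  qed
  have s2: "s k j = X * v * ((1 - v * inverse (p * u)) * (1 - A * u))"
  proof -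
    have "qpoch (inverse p ^ k) p j = qpoch (inverse p ^ k) p i * (1 - v * inverse (p * u))"
      using p by (simp add: Suc qpoch_Suc u_def v_def power_inverse field_simps)
    moreover have "qpoch (A * p ^ k) p j = (1 - A * u) * qpoch (A * p ^ Suc k) p i"
      by (simp add: Suc qpoch_Suc_left u_def mult_ac)
    ultimately show ?thesis by (simp add: s_def X_def v_def)
  qed
  have g1: "g k (Suc j) = (1 - A * p * u ^ 2) * (X * ((1 - v * inverse (p * u)) * (1 - A * u * v) * (1 - f * v)))"
  proof -
    have "qpoch (inverse p ^ k) p j = qpoch (inverse p ^ k) p i * (1 - v * inverse (p * u))"
      using p by (simp add: Suc qpoch_Suc u_def v_def power_inverse field_simps)
    moreover have "qpoch (A * p ^ Suc k) p j = qpoch (A * p ^ Suc k) p i * (1 - A * u * v)"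
      by (simp add: Suc qpoch_Suc u_def v_def mult_ac)
    moreover have "qpoch f p (Suc j) = qpoch f p j * (1 - f * v)"
      by (simp add: qpoch_Suc v_def)
    ultimately show ?thesis by (simp add: g_def X_def u_def)
  qed
  have g2: "g k j = (1 - A * p * u ^ 2) * (X * ((1 - v) * (1 - f * c * v * inverse p) * (1 - f * b * v * inverse p)))"
  proof -
    have e: "qpoch p p j = qpoch p p i * (1 - v)"
        "qpoch (f * c) p j = qpoch (f * c) p i * (1 - f * c * v * inverse p)"
        "qpoch (f * b) p j = qpoch (f * b) p i * (1 - f * b * v * inverse p)"
      using p by (simp_all add: Suc qpoch_Suc v field_simps)
    have n: "qpoch p p j \<noteq> 0" "qpoch (f * c) p j \<noteq> 0" "qpoch (f * b) p j \<noteq> 0"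
      using nz by (simp_all add: qpoch_nonzero)
    hence "1 - v \<noteq> 0" "1 - f * c * v * inverse p \<noteq> 0" "1 - f * b * v * inverse p \<noteq> 0"
      unfolding e by auto
    thus ?thesis unfolding X_def e by (simp add: g_def Suc u_def mult.assoc)
  qed
  show ?thesis
    unfolding s1 s2 g1 g2 using arg_cong[OF saal_identity[OF p u0 A, of v], of "\<lambda>t. X * t"]
    unfolding u_def[symmetric] by (simp add: algebra_simps)
qed

text \<open>WZ method: both sides satisfy the same first-order recurrence in k. Its coefficients are
  read off from the quotient of consecutive right-hand sides, and \<open>saal_telescope\<close>
  shows that the sum obeys it. The series is balanced because f c * f b = p * (A * f).\<close>

lemma q_saalschuetz:
  fixes p f b c A :: "'a::field"
  assumes p: "p \<noteq> 0" and A: "A * p = f * b * c"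
    and nz: "\<And>i. p * p ^ i \<noteq> 1" "\<And>i. f * c * p ^ i \<noteq> 1" "\<And>i. f * b * p ^ i \<noteq> 1"
  shows "(\<Sum>j\<le>k. qpoch (inverse p ^ k) p j * qpoch (A * p ^ k) p j * qpoch f p j * p ^ j
      / (qpoch p p j * qpoch (f * c) p j * qpoch (f * b) p j))
    = qpoch b p k * qpoch c p k * f ^ k / (qpoch (f * c) p k * qpoch (f * b) p k)"
proof (induction k)
  case 0
  thus ?case by simp
next
  case (Suc k)
  define s where "s k j = qpoch (inverse p ^ k) p j * qpoch (A * p ^ k) p j * qpoch f p j * p ^ j
      / (qpoch p p j * qpoch (f * c) p j * qpoch (f * b) p j)" for k j
  define g where "g j = (case j of 0 \<Rightarrow> 0 | Suc i \<Rightarrow> (1 - A * p * (p ^ k) ^ 2)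
      * (qpoch (inverse p ^ k) p i * qpoch (A * p ^ Suc k) p i * qpoch f p (Suc i)
      / (qpoch p p i * qpoch (f * c) p i * qpoch (f * b) p i)))" for j
  let ?\<alpha> = "(1 - f * c * p ^ k) * (1 - f * b * p ^ k)"
  let ?\<beta> = "f * (1 - b * p ^ k) * (1 - c * p ^ k)"
  have "?\<alpha> * (\<Sum>j\<le>Suc k. s (Suc k) j) - ?\<beta> * (\<Sum>j\<le>Suc k. s k j)
      = (\<Sum>j\<le>Suc k. ?\<alpha> * s (Suc k) j - ?\<beta> * s k j)"
    by (simp only: sum_distrib_left sum_subtractf)
  also have "\<dots> = (\<Sum>j\<le>Suc k. g (Suc j) - g j)"
    unfolding s_def g_def by (intro sum.cong refl saal_telescope[OF p A nz])
  also have "\<dots> = g (Suc (Suc k)) - g 0"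
    by (simp only: lessThan_Suc_atMost[symmetric] sum_lessThan_telescope)
  \<comment> \<open>\<open>g 0\<close> is 0 by definition, and \<open>g (Suc (Suc k))\<close>
    contains \<open>qpoch (inverse p ^ k) p (Suc k)\<close>, whose last factor is 0.\<close>
  also have "\<dots> = 0"
    by (simp add: g_def qpoch_inverse_power_eq_0[OF p])
  finally have "?\<alpha> * (\<Sum>j\<le>Suc k. s (Suc k) j) = ?\<beta> * (\<Sum>j\<le>Suc k. s k j)"
    by simp
  \<comment> \<open>The term j = k + 1 of the sum for k vanishes, so extending this sum to the range
    of the next one was harmless.\<close>
  also have "(\<Sum>j\<le>Suc k. s k j) = (\<Sum>j\<le>k. s k j)"
    by (simp add: s_def qpoch_inverse_power_eq_0[OF p])
  also have "\<dots> = qpoch b p k * qpoch c p k * f ^ k / (qpoch (f * c) p k * qpoch (f * b) p k)"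
    unfolding s_def by (rule Suc.IH)
  finally have "?\<alpha> * (\<Sum>j\<le>Suc k. s (Suc k) j) = \<dots> * ?\<beta>" by (simp only: mult.commute)
  moreover have "?\<alpha> \<noteq> 0" using nz by simp
  ultimately have "(\<Sum>j\<le>Suc k. s (Suc k) j)
      = qpoch b p k * qpoch c p k * f ^ k / (qpoch (f * c) p k * qpoch (f * b) p k) * ?\<beta> / ?\<alpha>"
    by (metis nonzero_mult_div_cancel_left)
  thus ?case unfolding s_def by (simp add: qpoch_Suc mult_ac)
qed

text \<open>The WZ pair for the recurrence in N: the two coefficients come from the quotient of the
  closed forms in \<open>terminating_sixphi5\<close> at N + 1 and N.\<close>

lemma sixphi5_telescope:
  fixes p f d e A :: "'a::field"
  assumes p: "p \<noteq> 0" and A: "A * p = f * d * e"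
    and nz: "\<And>i. p * p ^ i \<noteq> 1" "\<And>i. f * e * p ^ i \<noteq> 1" "\<And>i. f * d * p ^ i \<noteq> 1"
      "\<And>i. A * p * p ^ i \<noteq> 1"
  defines "s \<equiv> \<lambda>N k. (1 - A * p ^ (2 * k)) * qpoch A p k * qpoch d p k * qpoch e p k
        * qpoch (inverse p ^ N) p k * (f * p ^ N) ^ k
      / (qpoch p p k * qpoch (f * e) p k * qpoch (f * d) p k * qpoch (A * p ^ Suc N) p k)"
    and "g \<equiv> \<lambda>N k. case k of 0 \<Rightarrow> 0 | Suc i \<Rightarrow> (1 - A * p ^ Suc N)
      * (qpoch A p k * qpoch d p k * qpoch e p k * qpoch (inverse p ^ N) p i * (f * p ^ N) ^ k
      / (qpoch p p i * qpoch (f * e) p i * qpoch (f * d) p i * qpoch (A * p ^ Suc N) p k))"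
  shows "(1 - f * e * p ^ N) * (1 - f * d * p ^ N) * s (Suc N) k
      - (1 - A * p ^ Suc N) * (1 - f * p ^ N) * s N k = g N (Suc k) - g N k"
proof (cases k)
  case 0
  have "(1 - f * e * p ^ N) * (1 - f * d * p ^ N) * (1 - A)
      - (1 - f * d * e * p ^ N) * (1 - f * p ^ N) * (1 - A)
      = (1 - A) * (1 - d) * (1 - e) * (f * p ^ N)"
    by (simp add: algebra_simps)
  moreover have AU: "A * p ^ Suc N = f * d * e * p ^ N" using A by (simp add: mult.assoc[symmetric])
  moreover have "1 - A * p ^ Suc N \<noteq> 0" using nz(4)[of N] by (simp add: mult_ac)
  hence "g N (Suc 0) = (1 - A) * (1 - d) * (1 - e) * (f * p ^ N)"
    by (simp add: g_def qpoch_Suc del: power_Suc)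
  moreover have "s (Suc N) 0 = 1 - A" "s N 0 = 1 - A" "g N 0 = 0"
    by (simp_all add: s_def g_def)
  ultimately show ?thesis unfolding 0 by (simp only: diff_zero)
next
  case (Suc i)
  define U v where "U = p ^ N" and "v = p ^ k"
  \<comment> \<open>The last denominator has length k + 1 so that both products that occur divide
    it: removing its last factor gives the one in \<open>s N k\<close>, removing its first factor
    gives the one in \<open>s (Suc N) k\<close>.\<close>
  define X where "X = qpoch A p k * qpoch d p k * qpoch e p k * qpoch (inverse p ^ N) p i * (f * U) ^ k
      / (qpoch p p k * qpoch (f * e) p k * qpoch (f * d) p k * qpoch (A * p ^ Suc N) p (Suc k))"
  have v: "v = p ^ i * p" by (simp add: v_def Suc)
  have v2: "p ^ (2 * k) = v ^ 2" by (simp add: v_def power_mult[symmetric] mult.commute)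
  have U0: "U \<noteq> 0" using p by (simp add: U_def)
  have nz4: "A * p ^ Suc m * p ^ i \<noteq> 1" for m i
    using nz(4)[of "m + i"] by (simp add: power_add mult_ac)
  have n4: "qpoch (A * p ^ Suc N) p m \<noteq> 0" for m
    using nz4 by (intro qpoch_nonzero) auto
  have AU: "A * p ^ Suc N = A * p * U" by (simp add: U_def)
  have e4: "qpoch (A * p ^ Suc N) p (Suc k) = qpoch (A * p ^ Suc N) p k * (1 - A * p * U * v)"
    by (simp add: qpoch_Suc U_def v_def)
  have e4': "qpoch (A * p ^ Suc N) p (Suc k) = (1 - A * p * U) * qpoch (A * p ^ Suc (Suc N)) p k"
    by (simp add: qpoch_Suc_left U_def mult_ac)
  have n5: "1 - A * p * U * v \<noteq> 0" "1 - A * p * U \<noteq> 0"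
  proof -
    show "1 - A * p * U * v \<noteq> 0" using n4[of "Suc k"] unfolding e4 by simp
    show "1 - A * p * U \<noteq> 0" using n4[of "Suc k"] unfolding e4' by simp
  qed
  have eN: "qpoch (inverse p ^ N) p k = qpoch (inverse p ^ N) p i * (1 - v * inverse (p * U))"
    using p by (simp add: Suc qpoch_Suc U_def v_def power_inverse field_simps)
  have s1: "s (Suc N) k = (1 - A * p * U) * (X * (1 - A * v ^ 2) * v * (1 - inverse (p * U)))"
  proof -
    have "qpoch (inverse p ^ Suc N) p k = (1 - inverse (p * U)) * qpoch (inverse p ^ N) p i"
      using p by (simp add: Suc qpoch_Suc_left U_def power_inverse field_simps)
    moreover have "(f * p ^ Suc N) ^ k = (f * U) ^ k * v"
      by (simp add: U_def v_def power_mult_distrib power_mult[symmetric] mult_ac)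
    ultimately show ?thesis using n5 unfolding s_def X_def e4' v2 by (simp add: mult_ac)
  qed
  have s2: "s N k = X * (1 - A * v ^ 2) * (1 - v * inverse (p * U)) * (1 - A * p * U * v)"
    unfolding s_def X_def e4 eN v2 U_def[symmetric] using n5 by (simp add: mult_ac)
  have g1: "g N (Suc k) = (1 - A * p * U) * (X * ((1 - A * v) * (1 - d * v) * (1 - e * v)
      * (1 - v * inverse (p * U)) * (f * U)))"
    unfolding g_def X_def AU[symmetric] by (simp add: eN qpoch_Suc[of A] qpoch_Suc[of d] qpoch_Suc[of e] v_def[symmetric] U_def[symmetric])
  have g2: "g N k = (1 - A * p * U) * (X * ((1 - v) * (1 - f * e * v * inverse p)
      * (1 - f * d * v * inverse p) * (1 - A * p * U * v)))"
  proof -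
    have e: "qpoch p p k = qpoch p p i * (1 - v)"
        "qpoch (f * e) p k = qpoch (f * e) p i * (1 - f * e * v * inverse p)"
        "qpoch (f * d) p k = qpoch (f * d) p i * (1 - f * d * v * inverse p)"
      using p by (simp_all add: Suc qpoch_Suc v field_simps)
    have n: "qpoch p p k \<noteq> 0" "qpoch (f * e) p k \<noteq> 0" "qpoch (f * d) p k \<noteq> 0"
      using nz by (simp_all add: qpoch_nonzero)
    hence "1 - v \<noteq> 0" "1 - f * e * v * inverse p \<noteq> 0" "1 - f * d * v * inverse p \<noteq> 0"
      unfolding e by auto
    thus ?thesis using n5 unfolding X_def e(1) e(2) e(3) e4
      by (simp add: g_def Suc U_def mult.assoc)
  qed
  have pU: "p ^ N = U" by (simp add: U_def)
  \<comment> \<open>All terms share \<open>X\<close> and \<open>M = 1 - A * p * U\<close>. With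
    these pulled out, only \<open>sixphi5_identity\<close> remains to be applied.\<close>
  have aux: "a1 * a2 * (M * (X * Q * v * w)) - M * c * (X * Q * y * z) = M * (X * R) - M * (X * R')"
    if "Q * (a1 * a2 * w * v - c * y * z) = R - R'" for a1 a2 M Q w c y z R R' :: 'a
  proof -
    have "a1 * a2 * (M * (X * Q * v * w)) - M * c * (X * Q * y * z)
        = M * X * (Q * (a1 * a2 * w * v - c * y * z))" by (simp add: algebra_simps)
    thus ?thesis unfolding that by (simp add: algebra_simps)
  qed
  show ?thesis
    unfolding s1 s2 g1 g2 AU pU
    by (rule aux[OF sixphi5_identity[OF p U0 A]])
qed

text \<open>Again an induction on a first-order recurrence. The very-well-poised factor is not
  divided by 1 - A; hence the product on the right is \<open>qpoch A p (Suc N)\<close> instead of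
  \<open>qpoch (A * p) p N\<close>. Its last factors later supply the first power of the cyclotomic
  polynomial.\<close>

lemma terminating_sixphi5:
  fixes p f d e A :: "'a::field"
  assumes p: "p \<noteq> 0" and A: "A * p = f * d * e"
    and nz: "\<And>i. p * p ^ i \<noteq> 1" "\<And>i. f * e * p ^ i \<noteq> 1" "\<And>i. f * d * p ^ i \<noteq> 1"
      "\<And>i. A * p * p ^ i \<noteq> 1"
  shows "(\<Sum>k\<le>N. (1 - A * p ^ (2 * k)) * qpoch A p k * qpoch d p k * qpoch e p k
        * qpoch (inverse p ^ N) p k * (f * p ^ N) ^ k
      / (qpoch p p k * qpoch (f * e) p k * qpoch (f * d) p k * qpoch (A * p ^ Suc N) p k))
    = qpoch A p (Suc N) * qpoch f p N / (qpoch (f * e) p N * qpoch (f * d) p N)"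
proof (induction N)
  case 0
  thus ?case by (simp add: qpoch_Suc)
next
  case (Suc N)
  define s where "s N k = (1 - A * p ^ (2 * k)) * qpoch A p k * qpoch d p k * qpoch e p k
        * qpoch (inverse p ^ N) p k * (f * p ^ N) ^ k
      / (qpoch p p k * qpoch (f * e) p k * qpoch (f * d) p k * qpoch (A * p ^ Suc N) p k)" for N k
  define g where "g k = (case k of 0 \<Rightarrow> 0 | Suc i \<Rightarrow> (1 - A * p ^ Suc N)
      * (qpoch A p k * qpoch d p k * qpoch e p k * qpoch (inverse p ^ N) p i * (f * p ^ N) ^ k
      / (qpoch p p i * qpoch (f * e) p i * qpoch (f * d) p i * qpoch (A * p ^ Suc N) p k)))" for k
  let ?\<alpha> = "(1 - f * e * p ^ N) * (1 - f * d * p ^ N)"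
  let ?\<beta> = "(1 - A * p ^ Suc N) * (1 - f * p ^ N)"
  have "?\<alpha> * (\<Sum>k\<le>Suc N. s (Suc N) k) - ?\<beta> * (\<Sum>k\<le>Suc N. s N k)
      = (\<Sum>k\<le>Suc N. ?\<alpha> * s (Suc N) k - ?\<beta> * s N k)"
    by (simp only: sum_distrib_left sum_subtractf)
  also have "\<dots> = (\<Sum>k\<le>Suc N. g (Suc k) - g k)"
    unfolding s_def g_def by (intro sum.cong refl sixphi5_telescope[OF p A nz])
  also have "\<dots> = g (Suc (Suc N)) - g 0"
    by (simp only: lessThan_Suc_atMost[symmetric] sum_lessThan_telescope)
  also have "\<dots> = 0"
    by (simp add: g_def qpoch_inverse_power_eq_0[OF p])
  finally have "?\<alpha> * (\<Sum>k\<le>Suc N. s (Suc N) k) = ?\<beta> * (\<Sum>k\<le>Suc N. s N k)"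
    by simp
  also have "(\<Sum>k\<le>Suc N. s N k) = (\<Sum>k\<le>N. s N k)"
    by (simp add: s_def qpoch_inverse_power_eq_0[OF p])
  also have "\<dots> = qpoch A p (Suc N) * qpoch f p N / (qpoch (f * e) p N * qpoch (f * d) p N)"
    unfolding s_def by (rule Suc.IH)
  finally have "?\<alpha> * (\<Sum>k\<le>Suc N. s (Suc N) k) = \<dots> * ?\<beta>" by (simp only: mult.commute)
  moreover have "?\<alpha> \<noteq> 0" using nz by simp
  ultimately have "(\<Sum>k\<le>Suc N. s (Suc N) k)
      = qpoch A p (Suc N) * qpoch f p N / (qpoch (f * e) p N * qpoch (f * d) p N) * ?\<beta> / ?\<alpha>"
    by (metis nonzero_mult_div_cancel_left)
  thus ?case unfolding s_def by (simp add: qpoch_Suc[of _ _ N] qpoch_Suc[of _ _ "Suc N"] mult_ac)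
qed

text \<open>Reversing the factors of (p^(-k);p)_j, with k = j + m, yields a sign and a power of p.
  Apart from p^(jm) these form the product in \<open>claim\<close>, which does not depend on m and
  is eliminated by comparison with m = 0.\<close>

lemma qpoch_inverse_power_shift:
  fixes p :: "'a::field"
  assumes "p \<noteq> 0"
  shows "qpoch (inverse p ^ (j + m)) p j * p ^ (j * m) * (qpoch p p j * qpoch p p m)
    = qpoch (inverse p ^ j) p j * qpoch p p (j + m)"
proof -
  have claim: "qpoch (inverse p ^ (j + m)) p j * p ^ (j * m)
      = (\<Prod>i<j. - (inverse p ^ Suc i)) * qpoch (p * p ^ m) p j" for j m
  proof (induction j)
    case (Suc j)
    have h1: "qpoch (inverse p ^ (Suc j + m)) p (Suc j)
        = (1 - inverse p ^ (Suc j + m)) * qpoch (inverse p ^ (j + m)) p j"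
    proof -
      have "inverse p ^ (Suc j + m) * p = inverse p ^ (j + m)"
        using assms by (simp add: field_simps)
      thus ?thesis by (simp only: qpoch_Suc_left)
    qed
    have h2: "(1 - inverse p ^ (Suc j + m)) * p ^ m
        = - (inverse p ^ Suc j) * (1 - p * p ^ m * p ^ j)"
      using assms by (simp add: power_inverse power_add field_simps)
    have h3: "p ^ (Suc j * m) = p ^ m * p ^ (j * m)" by (simp add: power_add)
    have "qpoch (inverse p ^ (Suc j + m)) p (Suc j) * p ^ (Suc j * m)
        = ((1 - inverse p ^ (Suc j + m)) * p ^ m) * (qpoch (inverse p ^ (j + m)) p j * p ^ (j * m))"
      unfolding h1 h3 by (simp only: mult_ac)
    also note h2
    also note Suc.IH
    finally show ?case by (simp add: qpoch_Suc mult_ac)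
  qed simp
  have "qpoch p p (j + m) = qpoch p p m * qpoch (p * p ^ m) p j"
    using qpoch_add[of p p m j] by (simp only: add.commute)
  thus ?thesis using claim[of j m] claim[of j 0] by simp
qed

section \<open>The double sum behind Watson's transformation\<close>

lemma sum_triangle_swap:
  fixes F :: "nat \<Rightarrow> nat \<Rightarrow> 'a::comm_monoid_add"
  shows "(\<Sum>k\<le>N. \<Sum>j\<le>k. F j (k - j)) = (\<Sum>j\<le>N. \<Sum>m\<le>N - j. F j m)"
proof -
  have "(\<Sum>j\<le>N. \<Sum>m\<le>N - j. F j m) = (\<Sum>(j, m)\<in>{(j, m). j + m \<le> N}. F j m)"
    by (subst sum.Sigma) (auto intro!: sum.cong)
  thus ?thesis by (simp add: sum.triangle_reindex_eq)
qed

text \<open>Products of length j + m are cut after j factors; for A, the Saalschuetz factor first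
  extends the product to length 2j + m and the cut comes after 2j. What depends on m is the 6phi5
  summand with A p^(2j), d p^j, e p^j and N - j. The constraint A p = g d e survives this shift with
  the same g, so the inner sum can again be evaluated.\<close>

lemma watson_term:
  fixes p f b c g d e A :: "'a::field"
  assumes p: "p \<noteq> 0" and nz: "\<And>i. p * p ^ i \<noteq> 1" and k: "j + m \<le> N"
  defines "t \<equiv> \<lambda>A g d e N k. (1 - A * p ^ (2 * k)) * qpoch A p k * qpoch d p k * qpoch e p k
        * qpoch (inverse p ^ N) p k * (g * p ^ N) ^ k
      / (qpoch p p k * qpoch (g * e) p k * qpoch (g * d) p k * qpoch (A * p ^ Suc N) p k)"
  shows "t A g d e N (j + m) * (qpoch (inverse p ^ (j + m)) p j * qpoch (A * p ^ (j + m)) p j)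
    = qpoch A p (2 * j) * qpoch d p j * qpoch e p j * qpoch (inverse p ^ N) p j * (g * p ^ N) ^ j
      * qpoch (inverse p ^ j) p j
      / (qpoch p p j * qpoch (g * e) p j * qpoch (g * d) p j * qpoch (A * p ^ Suc N) p j)
      * t (A * p ^ (2 * j)) g (d * p ^ j) (e * p ^ j) (N - j) m"
proof -
  have n: "qpoch p p i \<noteq> 0" for i using nz by (simp add: qpoch_nonzero)
  have e1: "qpoch (inverse p ^ (j + m)) p j / qpoch p p (j + m)
      = qpoch (inverse p ^ j) p j / (qpoch p p j * qpoch p p m * p ^ (j * m))"
    using qpoch_inverse_power_shift[OF p, of j m] n p by (simp add: frac_eq_eq mult_ac)
  have e2: "qpoch A p (j + m) * qpoch (A * p ^ (j + m)) p j = qpoch A p (2 * j) * qpoch (A * p ^ (2 * j)) p m"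
    by (metis qpoch_add add.commute add.assoc mult_2)
  have e3: "qpoch (inverse p ^ N) p (j + m) = qpoch (inverse p ^ N) p j * qpoch (inverse p ^ (N - j)) p m"
  proof -
    have "inverse p ^ N * p ^ j = inverse p ^ (N - j)"
      using p k power_add[of p "N - j" j] by (simp add: power_inverse field_simps)
    thus ?thesis by (simp add: qpoch_add)
  qed
  \<comment> \<open>The power \<open>p ^ (j * m)\<close> left by the reversal in \<open>e1\<close>
    lowers the argument from g p^N to g p^(N - j), as the shifted 6phi5 requires.\<close>
  have e4: "(g * p ^ N) ^ (j + m) / p ^ (j * m) = (g * p ^ N) ^ j * (g * p ^ (N - j)) ^ m"
  proof -
    have "g * p ^ N = g * p ^ (N - j) * p ^ j"
      using k by (simp add: power_add[symmetric])
    hence "(g * p ^ N) ^ m = (g * p ^ (N - j)) ^ m * p ^ (j * m)"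
      by (metis power_mult_distrib power_mult)
    thus ?thesis using p by (simp add: power_add)
  qed
  have e5: "A * p ^ (2 * (j + m)) = A * p ^ (2 * j) * p ^ (2 * m)"
    by (simp add: power_add distrib_left)
  have e6: "qpoch (A * p ^ Suc N) p (j + m)
      = qpoch (A * p ^ Suc N) p j * qpoch (A * p ^ (2 * j) * p ^ Suc (N - j)) p m"
  proof -
    have "p ^ Suc N * p ^ j = p ^ (2 * j) * p ^ Suc (N - j)"
    proof -
      have "Suc N + j = 2 * j + Suc (N - j)" using k by simp
      thus ?thesis by (simp only: power_add[symmetric])
    qed
    thus ?thesis by (simp only: qpoch_add mult.assoc)
  qed
  have e7: "qpoch (g * e) p (j + m) = qpoch (g * e) p j * qpoch (g * (e * p ^ j)) p m"
      "qpoch (g * d) p (j + m) = qpoch (g * d) p j * qpoch (g * (d * p ^ j)) p m"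
    by (simp_all add: qpoch_add mult.assoc)
  have "t A g d e N (j + m) * (qpoch (inverse p ^ (j + m)) p j * qpoch (A * p ^ (j + m)) p j)
    = (1 - A * p ^ (2 * (j + m))) * (qpoch A p (j + m) * qpoch (A * p ^ (j + m)) p j)
      * qpoch d p (j + m) * qpoch e p (j + m) * qpoch (inverse p ^ N) p (j + m) * (g * p ^ N) ^ (j + m)
      / (qpoch (g * e) p (j + m) * qpoch (g * d) p (j + m) * qpoch (A * p ^ Suc N) p (j + m))
      * (qpoch (inverse p ^ (j + m)) p j / qpoch p p (j + m))"
    unfolding t_def by (simp add: mult_ac)
  also have "\<dots> = (1 - A * p ^ (2 * (j + m))) * (qpoch A p (j + m) * qpoch (A * p ^ (j + m)) p j)
      * qpoch d p (j + m) * qpoch e p (j + m) * qpoch (inverse p ^ N) p (j + m)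
      / (qpoch (g * e) p (j + m) * qpoch (g * d) p (j + m) * qpoch (A * p ^ Suc N) p (j + m))
      * (qpoch (inverse p ^ j) p j / (qpoch p p j * qpoch p p m)) * ((g * p ^ N) ^ (j + m) / p ^ (j * m))"
    unfolding e1 by (simp add: mult_ac)
  also have "\<dots> = qpoch A p (2 * j) * qpoch d p j * qpoch e p j * qpoch (inverse p ^ N) p j * (g * p ^ N) ^ j
      * qpoch (inverse p ^ j) p j
      / (qpoch p p j * qpoch (g * e) p j * qpoch (g * d) p j * qpoch (A * p ^ Suc N) p j)
      * t (A * p ^ (2 * j)) g (d * p ^ j) (e * p ^ j) (N - j) m"
    unfolding e2 e3 e4 e5 e6 e7 qpoch_add[of d] qpoch_add[of e] t_def
    by (simp only: divide_inverse inverse_mult_distrib power2_eq_square mult_ac)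
  finally show ?thesis .
qed

text \<open>
  Watson's transformation, where \<open>qpoch g p N\<close> and a denominator of the usual statement are merged
  into \<open>qpoch g p (N - j)\<close>: in the application that denominator may be divisible by the cyclotomic
  polynomial. Saalschuetz expands the parameters \<open>b\<close>, \<open>c\<close>; after exchanging the sums, the inner
  sum is a terminating \<open>6\<phi>5\<close>.
\<close>

lemma watson:
  fixes p f b c g d e A :: "'a::field"
  assumes p: "p \<noteq> 0" and A: "A * p = f * b * c" "A * p = g * d * e"
    and nz: "\<And>i. p * p ^ i \<noteq> 1" "\<And>i. f * c * p ^ i \<noteq> 1" "\<And>i. f * b * p ^ i \<noteq> 1"
      "\<And>i. g * e * p ^ i \<noteq> 1" "\<And>i. g * d * p ^ i \<noteq> 1" "\<And>i. A * p * p ^ i \<noteq> 1"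
  shows "(\<Sum>k\<le>N. (1 - A * p ^ (2 * k)) * qpoch A p k * qpoch b p k * qpoch c p k
        * qpoch d p k * qpoch e p k * qpoch (inverse p ^ N) p k * (f * g * p ^ N) ^ k
      / (qpoch p p k * qpoch (f * c) p k * qpoch (f * b) p k
        * qpoch (g * e) p k * qpoch (g * d) p k * qpoch (A * p ^ Suc N) p k))
    = (\<Sum>j\<le>N. qpoch A p (Suc N) * qpoch f p j * qpoch g p (N - j) * qpoch d p j * qpoch e p j
        * qpoch (inverse p ^ N) p j * qpoch (inverse p ^ j) p j * (g * p ^ Suc N) ^ j
      / (qpoch p p j ^ 2 * qpoch (f * c) p j * qpoch (f * b) p j
        * qpoch (g * e) p N * qpoch (g * d) p N))"
proof -
  define t where "t A g d e N k = (1 - A * p ^ (2 * k)) * qpoch A p k * qpoch d p k * qpoch e p k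
        * qpoch (inverse p ^ N) p k * (g * p ^ N) ^ k
      / (qpoch p p k * qpoch (g * e) p k * qpoch (g * d) p k * qpoch (A * p ^ Suc N) p k)" for A g d e N k
  define r where "r j = qpoch f p j * p ^ j / (qpoch p p j * qpoch (f * c) p j * qpoch (f * b) p j)" for j
  define C where "C j = qpoch A p (2 * j) * qpoch d p j * qpoch e p j * qpoch (inverse p ^ N) p j * (g * p ^ N) ^ j
      * qpoch (inverse p ^ j) p j
      / (qpoch p p j * qpoch (g * e) p j * qpoch (g * d) p j * qpoch (A * p ^ Suc N) p j)" for j
  have "(1 - A * p ^ (2 * k)) * qpoch A p k * qpoch b p k * qpoch c p k
        * qpoch d p k * qpoch e p k * qpoch (inverse p ^ N) p k * (f * g * p ^ N) ^ k
      / (qpoch p p k * qpoch (f * c) p k * qpoch (f * b) p k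
        * qpoch (g * e) p k * qpoch (g * d) p k * qpoch (A * p ^ Suc N) p k)
    = (\<Sum>j\<le>k. t A g d e N (j + (k - j))
        * (qpoch (inverse p ^ (j + (k - j))) p j * qpoch (A * p ^ (j + (k - j))) p j) * r j)"
    (is "?l k = ?r k") for k
  proof -
    \<comment> \<open>The products of b and c, their denominators and f^k form the closed
      Saalschuetz value; the rest is a 6phi5 summand with argument g p^N.\<close>
    have "?l k = t A g d e N k * (qpoch b p k * qpoch c p k * f ^ k / (qpoch (f * c) p k * qpoch (f * b) p k))"
      by (simp add: t_def power_mult_distrib mult_ac)
    also have "\<dots> = t A g d e N k * (\<Sum>j\<le>k. qpoch (inverse p ^ k) p j * qpoch (A * p ^ k) p j * r j)"
      unfolding q_saalschuetz[OF p A(1) nz(1-3), symmetric] r_def by (simp add: mult.assoc)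
    also have "\<dots> = ?r k" by (simp add: sum_distrib_left mult.assoc)
    finally show ?thesis .
  qed
  hence "(\<Sum>k\<le>N. ?l k) = (\<Sum>k\<le>N. ?r k)" by simp
  also have "\<dots> = (\<Sum>j\<le>N. \<Sum>m\<le>N - j. t A g d e N (j + m)
        * (qpoch (inverse p ^ (j + m)) p j * qpoch (A * p ^ (j + m)) p j) * r j)"
    by (rule sum_triangle_swap)
  also have "\<dots> = (\<Sum>j\<le>N. \<Sum>m\<le>N - j. C j * t (A * p ^ (2 * j)) g (d * p ^ j) (e * p ^ j) (N - j) m * r j)"
    unfolding t_def C_def using watson_term[OF p nz(1), of _ _ N A d e g]
    by (intro sum.cong refl) auto
  also have "\<dots> = (\<Sum>j\<le>N. C j * r j * (\<Sum>m\<le>N - j. t (A * p ^ (2 * j)) g (d * p ^ j) (e * p ^ j) (N - j) m))"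
    by (simp add: sum_distrib_left sum_distrib_right mult_ac)
  also have "\<dots> = (\<Sum>j\<le>N. qpoch A p (Suc N) * qpoch f p j * qpoch g p (N - j) * qpoch d p j * qpoch e p j
        * qpoch (inverse p ^ N) p j * qpoch (inverse p ^ j) p j * (g * p ^ Suc N) ^ j
      / (qpoch p p j ^ 2 * qpoch (f * c) p j * qpoch (f * b) p j
        * qpoch (g * e) p N * qpoch (g * d) p N))"
  proof (intro sum.cong refl)
    fix j assume "j \<in> {..N}"
    hence j: "j \<le> N" by simp
    have A': "A * p ^ (2 * j) * p = g * (d * p ^ j) * (e * p ^ j)"
      using A(2) by (simp add: mult_2 power_add)
    have "(\<Sum>m\<le>N - j. t (A * p ^ (2 * j)) g (d * p ^ j) (e * p ^ j) (N - j) m)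
      = qpoch (A * p ^ (2 * j)) p (Suc (N - j)) * qpoch g p (N - j)
        / (qpoch (g * (e * p ^ j)) p (N - j) * qpoch (g * (d * p ^ j)) p (N - j))"
      unfolding t_def
    proof (rule terminating_sixphi5[OF p A' nz(1)])
      show "g * (e * p ^ j) * p ^ i \<noteq> 1" for i
        using nz(4)[of "j + i"] by (simp add: power_add mult.assoc)
      show "g * (d * p ^ j) * p ^ i \<noteq> 1" for i
        using nz(5)[of "j + i"] by (simp add: power_add mult.assoc)
      show "A * p ^ (2 * j) * p * p ^ i \<noteq> 1" for i
        using nz(6)[of "2 * j + i"] by (simp add: power_add mult_ac)
    qed
    \<comment> \<open>This regrouping makes the leading product independent of j and cancels the
      denominator \<open>qpoch (A * p ^ Suc N) p j\<close> of \<open>C j\<close>.\<close>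
    moreover have "qpoch A p (2 * j) * qpoch (A * p ^ (2 * j)) p (Suc (N - j))
        = qpoch A p (Suc N) * qpoch (A * p ^ Suc N) p j"
    proof -
      have "2 * j + Suc (N - j) = Suc N + j" using j by simp
      thus ?thesis by (simp only: qpoch_add[symmetric])
    qed
    moreover have "qpoch (A * p ^ Suc N) p j \<noteq> 0"
    proof (rule qpoch_nonzero)
      show "A * p ^ Suc N * p ^ i \<noteq> 1" for i
        using nz(6)[of "N + i"] by (simp add: power_add mult_ac)
    qed
    moreover have "qpoch (g * e) p N = qpoch (g * e) p j * qpoch (g * (e * p ^ j)) p (N - j)"
        "qpoch (g * d) p N = qpoch (g * d) p j * qpoch (g * (d * p ^ j)) p (N - j)"
      using qpoch_add[of _ p j "N - j"] j by (simp_all add: mult.assoc)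
    ultimately show "C j * r j * (\<Sum>m\<le>N - j. t (A * p ^ (2 * j)) g (d * p ^ j) (e * p ^ j) (N - j) m)
      = qpoch A p (Suc N) * qpoch f p j * qpoch g p (N - j) * qpoch d p j * qpoch e p j
        * qpoch (inverse p ^ N) p j * qpoch (inverse p ^ j) p j * (g * p ^ Suc N) ^ j
      / (qpoch p p j ^ 2 * qpoch (f * c) p j * qpoch (f * b) p j
        * qpoch (g * e) p N * qpoch (g * d) p N)"
      (is "_ = ?rhs")
      using j
    proof -
      assume S: "(\<Sum>m\<le>N - j. t (A * p ^ (2 * j)) g (d * p ^ j) (e * p ^ j) (N - j) m)
          = qpoch (A * p ^ (2 * j)) p (Suc (N - j)) * qpoch g p (N - j)
            / (qpoch (g * (e * p ^ j)) p (N - j) * qpoch (g * (d * p ^ j)) p (N - j))"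
        and AA: "qpoch A p (2 * j) * qpoch (A * p ^ (2 * j)) p (Suc (N - j))
          = qpoch A p (Suc N) * qpoch (A * p ^ Suc N) p j"
        and n: "qpoch (A * p ^ Suc N) p j \<noteq> 0"
        and B: "qpoch (g * e) p N = qpoch (g * e) p j * qpoch (g * (e * p ^ j)) p (N - j)"
          "qpoch (g * d) p N = qpoch (g * d) p j * qpoch (g * (d * p ^ j)) p (N - j)"
      let ?Y = "qpoch f p j * qpoch g p (N - j) * qpoch d p j * qpoch e p j
        * qpoch (inverse p ^ N) p j * qpoch (inverse p ^ j) p j * (g * p ^ Suc N) ^ j
      / (qpoch p p j ^ 2 * qpoch (f * c) p j * qpoch (f * b) p j
        * qpoch (g * e) p N * qpoch (g * d) p N)"
      have "C j * r j * (qpoch (A * p ^ (2 * j)) p (Suc (N - j)) * qpoch g p (N - j)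
            / (qpoch (g * (e * p ^ j)) p (N - j) * qpoch (g * (d * p ^ j)) p (N - j)))
        = (qpoch A p (2 * j) * qpoch (A * p ^ (2 * j)) p (Suc (N - j)))
          / qpoch (A * p ^ Suc N) p j * ?Y"
        unfolding C_def r_def B by (simp add: power_mult_distrib power2_eq_square power3_eq_cube mult_ac)
      also have "\<dots> = ?rhs" unfolding AA using n by simp
      finally show ?thesis unfolding S .
    qed
  qed
  finally show ?thesis .
qed

subsection \<open>Divisibility in a localisation\<close>

text \<open>
  \<open>P\<close> need not be prime: denominators are only required to be coprime to \<open>P\<close>. This makes the
  irreducibility of cyclotomic polynomials dispensable.
\<close>

definition loc_ideal ::
    "'a::{factorial_ring_gcd,semiring_gcd_mult_normalize} \<Rightarrow> nat \<Rightarrow> 'a fract set" where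
  "loc_ideal P m = {to_fract (P ^ m * u) / to_fract v | u v. v \<noteq> 0 \<and> coprime P v}"

definition loc_units ::
    "'a::{factorial_ring_gcd,semiring_gcd_mult_normalize} \<Rightarrow> 'a fract set" where
  "loc_units P = {to_fract u / to_fract v | u v. u \<noteq> 0 \<and> v \<noteq> 0 \<and> coprime P u \<and> coprime P v}"

lemma to_fract_power: "to_fract (x ^ m) = to_fract x ^ m"
  by (induction m) simp_all

lemma loc_idealI:
  "v \<noteq> 0 \<Longrightarrow> coprime P v \<Longrightarrow> z = to_fract (P ^ m * u) / to_fract v \<Longrightarrow> z \<in> loc_ideal P m"
  unfolding loc_ideal_def by blast

lemma loc_idealE:
  assumes "z \<in> loc_ideal P m"
  obtains u v where "v \<noteq> 0" "coprime P v" "z = to_fract (P ^ m * u) / to_fract v"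
  using assms unfolding loc_ideal_def by blast

lemma loc_unitsI:
  "u \<noteq> 0 \<Longrightarrow> v \<noteq> 0 \<Longrightarrow> coprime P u \<Longrightarrow> coprime P v \<Longrightarrow> z = to_fract u / to_fract v \<Longrightarrow> z \<in> loc_units P"
  unfolding loc_units_def by blast

lemma loc_unitsE:
  assumes "z \<in> loc_units P"
  obtains u v where "u \<noteq> 0" "v \<noteq> 0" "coprime P u" "coprime P v" "z = to_fract u / to_fract v"
  using assms unfolding loc_units_def by blast

lemma loc_units_to_fract: "u \<noteq> 0 \<Longrightarrow> coprime P u \<Longrightarrow> to_fract u \<in> loc_units P"
  by (rule loc_unitsI[of u 1]) simp_all

lemma loc_ideal_to_fract: "P ^ m dvd u \<Longrightarrow> to_fract u \<in> loc_ideal P m"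
  unfolding dvd_def by (auto intro!: loc_idealI[of 1])

lemma loc_ideal_0 [simp]: "0 \<in> loc_ideal P m"
  using loc_ideal_to_fract[of P m 0] by simp

lemma loc_ideal_1 [simp]: "1 \<in> loc_ideal P 0"
  using loc_ideal_to_fract[of P 0 1] by simp

lemma loc_units_1 [simp]: "1 \<in> loc_units P"
  using loc_units_to_fract[of 1 P] by simp

lemma loc_ideal_add:
  assumes "x \<in> loc_ideal P m" "y \<in> loc_ideal P m"
  shows "x + y \<in> loc_ideal P m"
proof -
  from assms obtain u v u' v' where
    *: "v \<noteq> 0" "coprime P v" "x = to_fract (P ^ m * u) / to_fract v"
      "v' \<noteq> 0" "coprime P v'" "y = to_fract (P ^ m * u') / to_fract v'"
    by (elim loc_idealE)
  show ?thesis
    by (rule loc_idealI[of "v * v'" _ _ _ "u * v' + u' * v"]) (use * in \<open>simp_all add: field_simps\<close>)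
qed

lemma loc_ideal_mult:
  assumes "x \<in> loc_ideal P m" "y \<in> loc_ideal P k"
  shows "x * y \<in> loc_ideal P (m + k)"
proof -
  from assms obtain u v u' v' where
    *: "v \<noteq> 0" "coprime P v" "x = to_fract (P ^ m * u) / to_fract v"
      "v' \<noteq> 0" "coprime P v'" "y = to_fract (P ^ k * u') / to_fract v'"
    by (elim loc_idealE)
  show ?thesis
    unfolding *(3,6) by (rule loc_idealI[of "v * v'" _ _ _ "u * u'"]) (use * in \<open>simp_all add: power_add\<close>)
qed

lemma loc_ideal_uminus: "x \<in> loc_ideal P m \<Longrightarrow> - x \<in> loc_ideal P m"
  by (elim loc_idealE, rule loc_idealI[of _ _ _ _ "- u" for u]) auto

lemma loc_ideal_diff: "x \<in> loc_ideal P m \<Longrightarrow> y \<in> loc_ideal P m \<Longrightarrow> x - y \<in> loc_ideal P m"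
  using loc_ideal_add[of x P m "- y"] loc_ideal_uminus[of y] by simp

lemma loc_ideal_mult_left: "x \<in> loc_ideal P 0 \<Longrightarrow> y \<in> loc_ideal P m \<Longrightarrow> x * y \<in> loc_ideal P m"
  using loc_ideal_mult[of x P 0 y m] by simp

lemma loc_ideal_mult_right: "x \<in> loc_ideal P m \<Longrightarrow> y \<in> loc_ideal P 0 \<Longrightarrow> x * y \<in> loc_ideal P m"
  using loc_ideal_mult[of x P m y 0] by simp

lemma loc_ideal_sum: "(\<And>i. i \<in> I \<Longrightarrow> f i \<in> loc_ideal P m) \<Longrightarrow> sum f I \<in> loc_ideal P m"
  by (induction I rule: infinite_finite_induct) (simp_all add: loc_ideal_add)

lemma loc_ideal_antimono:
  assumes "x \<in> loc_ideal P m" "k \<le> m"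
  shows "x \<in> loc_ideal P k"
proof -
  from assms(1) obtain u v where *: "v \<noteq> 0" "coprime P v" "x = to_fract (P ^ m * u) / to_fract v"
    by (elim loc_idealE)
  have "P ^ m = P ^ k * P ^ (m - k)" using assms(2) by (simp add: power_add[symmetric])
  thus ?thesis by (intro loc_idealI[of v _ _ _ "P ^ (m - k) * u"]) (use * in \<open>simp_all add: mult.assoc\<close>)
qed

lemma loc_units_in_ideal: "x \<in> loc_units P \<Longrightarrow> x \<in> loc_ideal P 0"
  by (elim loc_unitsE, rule loc_idealI) auto

lemma loc_units_nonzero: "x \<in> loc_units P \<Longrightarrow> x \<noteq> 0"
  by (elim loc_unitsE) auto

lemma loc_units_inverse: "x \<in> loc_units P \<Longrightarrow> inverse x \<in> loc_units P"
  by (elim loc_unitsE, rule loc_unitsI) auto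

lemma loc_units_mult:
  assumes "x \<in> loc_units P" "y \<in> loc_units P"
  shows "x * y \<in> loc_units P"
proof -
  from assms obtain u v u' v' where
    *: "u \<noteq> 0" "v \<noteq> 0" "coprime P u" "coprime P v" "x = to_fract u / to_fract v"
      "u' \<noteq> 0" "v' \<noteq> 0" "coprime P u'" "coprime P v'" "y = to_fract u' / to_fract v'"
    by (elim loc_unitsE)
  show ?thesis
    by (rule loc_unitsI[of "u * u'" "v * v'"]) (use * in simp_all)
qed

lemma loc_units_divide: "x \<in> loc_units P \<Longrightarrow> y \<in> loc_units P \<Longrightarrow> x / y \<in> loc_units P"
  unfolding divide_inverse by (intro loc_units_mult loc_units_inverse)

lemma loc_units_power: "x \<in> loc_units P \<Longrightarrow> x ^ k \<in> loc_units P"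
  by (induction k) (simp_all add: loc_units_mult)

lemma loc_units_uminus: "x \<in> loc_units P \<Longrightarrow> - x \<in> loc_units P"
  by (elim loc_unitsE, rule loc_unitsI[of "- u" for u]) auto

lemma loc_units_prod: "(\<And>i. i \<in> I \<Longrightarrow> f i \<in> loc_units P) \<Longrightarrow> prod f I \<in> loc_units P"
  by (induction I rule: infinite_finite_induct) (simp_all add: loc_units_mult)

lemma loc_ideal_divide: "x \<in> loc_ideal P m \<Longrightarrow> y \<in> loc_units P \<Longrightarrow> x / y \<in> loc_ideal P m"
  unfolding divide_inverse by (intro loc_ideal_mult_right loc_units_in_ideal loc_units_inverse)

lemma loc_ideal_power: "x \<in> loc_ideal P 0 \<Longrightarrow> x ^ k \<in> loc_ideal P 0"
  by (induction k) (simp_all add: loc_ideal_mult_left)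

lemma loc_ideal_prod: "(\<And>i. i \<in> I \<Longrightarrow> f i \<in> loc_ideal P 0) \<Longrightarrow> prod f I \<in> loc_ideal P 0"
  by (induction I rule: infinite_finite_induct) (simp_all add: loc_ideal_mult_left)

lemma loc_ideal_prod_1:
  assumes "finite I" "i \<in> I" "f i \<in> loc_ideal P m" "\<And>i. i \<in> I \<Longrightarrow> f i \<in> loc_ideal P 0"
  shows "prod f I \<in> loc_ideal P m"
  using assms by (subst prod.remove[of I i]) (auto intro!: loc_ideal_mult_right loc_ideal_prod)

lemma loc_ideal_prod_diff:
  assumes "\<And>i. i \<in> I \<Longrightarrow> f i \<in> loc_ideal P 0" "\<And>i. i \<in> I \<Longrightarrow> g i \<in> loc_ideal P 0"
    "\<And>i. i \<in> I \<Longrightarrow> f i - g i \<in> loc_ideal P m"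
  shows "prod f I - prod g I \<in> loc_ideal P m"
  using assms
proof (induction I rule: infinite_finite_induct)
  case (insert i I)
  have "prod f (insert i I) - prod g (insert i I)
      = f i * (prod f I - prod g I) + (f i - g i) * prod g I"
    using insert by (simp add: algebra_simps)
  also have "\<dots> \<in> loc_ideal P m"
    using insert by (intro loc_ideal_add loc_ideal_mult_left[of "f i"] loc_ideal_mult_right loc_ideal_prod) auto
  finally show ?case .
qed simp_all

lemma loc_ideal_divide_diff:
  assumes "u \<in> loc_ideal P 0" "v \<in> loc_units P" "v' \<in> loc_units P"
    "u - u' \<in> loc_ideal P m" "v - v' \<in> loc_ideal P m"
  shows "u / v - u' / v' \<in> loc_ideal P m"
proof -
  have "u / v - u' / v' = ((u - u') * v - u * (v - v')) / (v * v')"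
    using loc_units_nonzero[OF assms(2)] loc_units_nonzero[OF assms(3)]
    by (simp add: diff_frac_eq algebra_simps)
  also have "\<dots> \<in> loc_ideal P m"
  proof -
    have "(u - u') * v \<in> loc_ideal P m"
      using assms by (intro loc_ideal_mult_right loc_units_in_ideal)
    moreover have "u * (v - v') \<in> loc_ideal P m"
      using assms by (intro loc_ideal_mult_left)
    ultimately show ?thesis
      using assms by (intro loc_ideal_divide loc_ideal_diff loc_units_mult)
  qed
  finally show ?thesis .
qed

text \<open>The way back from the localisation to \<open>ratfun_cong\<close>: cross-multiplying with
  the reduced form shows that P^m divides the numerator times v, and v is coprime to P.\<close>

lemma loc_ideal_imp_dvd:
  assumes "z \<in> loc_ideal P m"
  shows "P ^ m dvd fst (quot_of_fract z)"
proof -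
  from assms obtain u v where *: "v \<noteq> 0" "coprime P v" "z = to_fract (P ^ m * u) / to_fract v"
    by (elim loc_idealE)
  have "z = to_fract (fst (quot_of_fract z)) / to_fract (snd (quot_of_fract z))"
    by (metis Fract_conv_to_fract Fract_quot_of_fract)
  hence "to_fract (fst (quot_of_fract z) * v) = to_fract (P ^ m * u * snd (quot_of_fract z))"
    using * by (simp add: frac_eq_eq)
  hence "fst (quot_of_fract z) * v = P ^ m * (u * snd (quot_of_fract z))"
    unfolding to_fract_eq_iff by (simp add: mult.assoc)
  hence "P ^ m dvd fst (quot_of_fract z) * v" by simp
  moreover have "coprime (P ^ m) v" using * by simp
  ultimately show ?thesis by (simp add: coprime_dvd_mult_left_iff)
qed

subsection \<open>Cyclotomic polynomials and factors of \<open>q\<close>-shifted factorials\<close>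

text \<open>As B is monic, pseudo-division is division with remainder over the integers. The
  remainder is divisible by B over the complex numbers but has smaller degree, so it is 0.\<close>

lemma monic_dvd_of_complex_dvd:
  fixes B F :: "int poly"
  assumes lc: "lead_coeff B = 1"
    and dvd: "(map_poly of_int B :: complex poly) dvd map_poly of_int F"
  shows "B dvd F"
proof -
  have degB: "degree (map_poly of_int p :: complex poly) = degree p" for p
    by (rule degree_map_poly) auto
  have B0: "B \<noteq> 0" using lc by auto
  obtain Q R where QR: "pseudo_divmod F B = (Q, R)" by force
  from pseudo_divmod[OF B0 QR] have F: "F = B * Q + R" and R: "R = 0 \<or> degree R < degree B"
    by (simp_all add: lc)
  have "(map_poly of_int B :: complex poly) dvd map_poly of_int R"
    using dvd unfolding F map_poly_of_int_add map_poly_of_int_mult by (simp add: dvd_add_right_iff)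
  hence "map_poly of_int R = (0 :: complex poly)"
    using R dvd_imp_degree_le[of "map_poly of_int B :: complex poly" "map_poly of_int R"]
    unfolding degB by fastforce
  hence "R = 0" using map_poly_of_int_eq_iff[of R 0] by simp
  thus ?thesis using F by simp
qed

lemma lead_coeff_cyclotomic: "n > 0 \<Longrightarrow> lead_coeff (cyclotomic n) = 1"
proof -
  assume n: "n > 0"
  have "degree (map_poly of_int (cyclotomic n) :: complex poly) = degree (cyclotomic n)"
    by (rule degree_map_poly) auto
  hence "of_int (lead_coeff (cyclotomic n)) = lead_coeff (map_poly of_int (cyclotomic n) :: complex poly)"
    by (simp add: coeff_map_poly)
  also have "\<dots> = 1" unfolding cyclotomic_spec[OF n] by (simp add: lead_coeff_prod)
  finally show ?thesis by (metis of_int_eq_1_iff)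
qed

lemma cyclotomic_dvd:
  assumes "n > 0" "n dvd m"
  shows "cyclotomic n dvd 1 - monom 1 m"
proof -
  have root: "primitive_roots_unity n \<subseteq> {z. z ^ n = 1}"
    by (auto simp: primitive_roots_unity_def)
  have "(\<Prod>z\<in>primitive_roots_unity n. [:- z, 1:]) dvd (\<Prod>z | z ^ n = 1. [:- z, 1:] :: complex poly)"
    using finite_roots_unity[of n] assms root by (intro prod_dvd_prod_subset) auto
  hence "map_poly of_int (cyclotomic n) dvd (monom 1 n - 1 :: complex poly)"
    unfolding cyclotomic_spec[OF assms(1)] prod_roots_unity[OF assms(1)] .
  moreover have "map_poly of_int (monom 1 n - 1) = (monom 1 n - 1 :: complex poly)"
    by (simp add: map_poly_of_int_diff map_poly_monom)
  ultimately have "cyclotomic n dvd monom 1 n - 1"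
    by (intro monic_dvd_of_complex_dvd lead_coeff_cyclotomic assms) simp
  also have "monom 1 n - 1 dvd (monom 1 m - 1 :: int poly)"
  proof -
    obtain k where "m = n * k" using assms(2) by auto
    hence "monom 1 m - 1 = (monom 1 n :: int poly) ^ k - 1" by (simp add: monom_power)
    thus ?thesis by (simp add: power_diff_1_eq)
  qed
  also have "\<dots> dvd 1 - monom 1 m"
    by (metis dvd_minus_iff dvd_refl minus_diff_eq)
  finally show ?thesis .
qed

text \<open>A nonconstant common divisor has a complex root, which is then a primitive n-th root of
  unity and a root of D. A constant one divides the leading coefficient 1.\<close>

lemma coprime_cyclotomic:
  assumes n: "n > 0"
    and D: "\<And>z. z \<in> primitive_roots_unity n \<Longrightarrow> poly (map_poly of_int D) z \<noteq> 0"
  shows "coprime (cyclotomic n) D"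
proof (rule coprimeI)
  fix f assume f: "f dvd cyclotomic n" "f dvd D"
  have eval: "poly (map_poly of_int h) z = 0" if "poly (map_poly of_int f) z = 0" "f dvd h"
    for h and z :: complex
    using that by (auto simp: map_poly_of_int_mult elim!: dvdE)
  have degf: "degree (map_poly of_int f :: complex poly) = degree f"
    by (rule degree_map_poly) auto
  have "degree f = 0"
  proof (rule ccontr)
    assume "degree f \<noteq> 0"
    hence "\<not> constant (poly (map_poly of_int f :: complex poly))"
      using constant_degree degf by metis
    then obtain z :: complex where z: "poly (map_poly of_int f) z = 0"
      using fundamental_theorem_of_algebra by blast
    from eval[OF z f(1)] have "z \<in> primitive_roots_unity n"
      unfolding cyclotomic_spec[OF n] using finite_primitive_roots_unity[OF n]
      by (auto simp: poly_prod)
    thus False using D eval[OF z f(2)] by blast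
  qed
  then obtain c where c: "f = [:c:]" by (elim degree_eq_zeroE)
  have "c dvd lead_coeff (cyclotomic n)"
    using f(1) unfolding c const_poly_dvd_iff by blast
  thus "is_unit f" unfolding c lead_coeff_cyclotomic[OF n] by (simp add: is_unit_const_poly_iff)
qed

lemma coprime_cyclotomic_monom:
  assumes "n > 0" "\<not> n dvd m"
  shows "coprime (cyclotomic n) (1 - monom 1 m)"
proof (rule coprime_cyclotomic[OF assms(1)])
  fix z assume z: "z \<in> primitive_roots_unity n"
  have "z ^ m = (z ^ n) ^ (m div n) * z ^ (m mod n)"
    by (simp add: power_mult[symmetric] power_add[symmetric])
  hence "z ^ m = z ^ (m mod n)" using z by (simp add: primitive_roots_unity_def)
  moreover have "m mod n \<in> {1..<n}" using assms by (auto simp: dvd_eq_mod_eq_0 Suc_le_eq)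
  ultimately have "z ^ m \<noteq> 1" using z by (auto simp: primitive_roots_unity_def)
  thus "poly (map_poly of_int (1 - monom 1 m)) z \<noteq> 0"
    by (simp add: map_poly_of_int_diff map_poly_monom poly_monom)
qed

lemma coprime_cyclotomic_X:
  assumes "n > 0"
  shows "coprime (cyclotomic n) [:0, 1:]"
  using assms by (intro coprime_cyclotomic)
    (auto simp: primitive_roots_unity_def map_poly_pCons power_0_left)

text \<open>Meant for cyclotomic polynomials viewed as constants in a: their divisors are constants
  in a too, and such a constant divides D only if it divides every coefficient of D.\<close>

lemma coprime_const_poly:
  fixes C :: "'a::{factorial_ring_gcd,semiring_gcd_mult_normalize}"
  assumes "C \<noteq> 0" and "\<And>c. c dvd C \<Longrightarrow> (\<And>i. c dvd coeff D i) \<Longrightarrow> is_unit c"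
  shows "coprime [:C:] D"
proof (rule coprimeI)
  fix f assume f: "f dvd [:C:]" "f dvd D"
  have "degree f = 0" using dvd_imp_degree_le[OF f(1)] assms(1) by simp
  then obtain c where c: "f = [:c:]" by (elim degree_eq_zeroE)
  have "c dvd C" using f(1) unfolding c by simp
  moreover have "c dvd coeff D i" for i using f(2) unfolding c const_poly_dvd_iff by blast
  ultimately show "is_unit f" unfolding c is_unit_const_poly_iff by (rule assms(2))
qed

section \<open>Powers of q and linear factors in a inside the localisation\<close>

lemma ratfun_q_nonzero [simp]: "ratfun_q \<noteq> 0"
  by (simp add: ratfun_q_def)

lemma ratfun_a_nonzero [simp]: "ratfun_a \<noteq> 0"
  by (simp add: ratfun_a_def)

lemma ratfun_q_power: "ratfun_q ^ m = to_fract [:monom 1 m:]"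
proof -
  have "[:0, 1:] ^ m = (monom 1 m :: int poly)" by (simp add: monom_altdef)
  thus ?thesis by (simp only: ratfun_q_def poly_const_pow flip: to_fract_power)
qed

lemma ratfun_q_powi_eq_1_iff: "ratfun_q powi k = 1 \<longleftrightarrow> k = 0"
proof -
  have nat: "ratfun_q ^ m = 1 \<longleftrightarrow> m = 0" for m
  proof
    assume "ratfun_q ^ m = 1"
    hence "to_fract [:monom 1 m :: int poly:] = to_fract 1" by (simp only: ratfun_q_power to_fract_1)
    hence "monom 1 m = (1 :: int poly)" unfolding to_fract_eq_iff by (simp add: one_pCons)
    thus "m = 0" using degree_monom_eq[of "1::int" m] by simp
  qed simp
  show ?thesis
    by (cases k) (simp_all add: nat power_int_minus flip: of_nat_Suc del: power_Suc)
qed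

lemma cyclotomic_nonzero: "n > 0 \<Longrightarrow> cyclotomic n \<noteq> 0"
  using lead_coeff_cyclotomic[of n] by auto

lemma ratfun_q_unit: "n > 0 \<Longrightarrow> ratfun_q \<in> loc_units [:cyclotomic n:]"
proof -
  assume n: "n > 0"
  have "coprime [:cyclotomic n:] [:[:0, 1:]:]"
  proof (rule coprime_const_poly[OF cyclotomic_nonzero[OF n]])
    fix c :: "int poly" assume c: "c dvd cyclotomic n" "\<And>i. c dvd coeff [:[:0, 1:]:] i"
    show "is_unit c" using c(2)[of 0] c(1) coprime_cyclotomic_X[OF n] by (auto dest: coprime_common_divisor)
  qed
  thus ?thesis unfolding ratfun_q_def by (intro loc_units_to_fract) auto
qed

lemma ratfun_q_powi_unit: "n > 0 \<Longrightarrow> ratfun_q powi k \<in> loc_units [:cyclotomic n:]"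
  by (cases k) (simp_all add: power_int_minus loc_units_inverse loc_units_power ratfun_q_unit
      flip: of_nat_Suc del: power_Suc)

lemma one_minus_ratfun_q_powi_unit:
  assumes n: "n > 0" and k: "\<not> int n dvd k"
  shows "1 - ratfun_q powi k \<in> loc_units [:cyclotomic n:]"
proof -
  have nat: "1 - ratfun_q ^ m \<in> loc_units [:cyclotomic n:]" if m: "\<not> n dvd m" for m
  proof -
    have cop: "coprime (cyclotomic n) (1 - monom 1 m)" using n m by (rule coprime_cyclotomic_monom)
    have "coprime [:cyclotomic n:] [:1 - monom 1 m:]"
    proof (rule coprime_const_poly[OF cyclotomic_nonzero[OF n]])
      fix c :: "int poly" assume c: "c dvd cyclotomic n" "\<And>i. c dvd coeff [:1 - monom 1 m:] i"
      show "is_unit c" using c(2)[of 0] c(1) cop by (auto dest: coprime_common_divisor)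
    qed
    moreover have "1 - monom 1 m \<noteq> (0 :: int poly)"
    proof
      assume "1 - monom 1 m = (0 :: int poly)"
      hence "monom 1 m = (1 :: int poly)" by simp
      hence "m = 0" using degree_monom_eq[of "1::int" m] by simp
      thus False using m by simp
    qed
    ultimately have "to_fract [:1 - monom 1 m:] \<in> loc_units [:cyclotomic n:]"
      by (intro loc_units_to_fract) auto
    also have "to_fract [:1 - monom 1 m:] = 1 - ratfun_q ^ m"
      unfolding ratfun_q_power to_fract_1[symmetric] to_fract_diff[symmetric] by (simp add: one_pCons)
    finally show ?thesis .
  qed
  show ?thesis
  proof (cases "k \<ge> 0")
    case True
    then obtain m where "k = int m" using nonneg_int_cases by blast
    thus ?thesis using nat k by simp
  next
    case False
    hence "k = - int (nat (- k))" by simp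
    then obtain m where m: "k = - int m" by blast
    have "1 - ratfun_q powi k = - ((1 - ratfun_q ^ m) / ratfun_q ^ m)"
      by (simp add: m power_int_minus field_simps)
    also have "\<dots> \<in> loc_units [:cyclotomic n:]"
      using nat k n m by (intro loc_units_uminus loc_units_divide loc_units_power ratfun_q_unit) auto
    finally show ?thesis .
  qed
qed

lemma one_minus_ratfun_q_powi_ideal:
  assumes n: "n > 0" and k: "int n dvd k"
  shows "1 - ratfun_q powi k \<in> loc_ideal [:cyclotomic n:] 1"
proof -
  have nat: "1 - ratfun_q ^ m \<in> loc_ideal [:cyclotomic n:] 1" if m: "n dvd m" for m
  proof -
    have "[:cyclotomic n:] ^ 1 dvd [:1 - monom 1 m:]"
      using cyclotomic_dvd[OF n m] by simp
    hence "to_fract [:1 - monom 1 m:] \<in> loc_ideal [:cyclotomic n:] 1"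
      by (rule loc_ideal_to_fract)
    also have "to_fract [:1 - monom 1 m:] = 1 - ratfun_q ^ m"
      unfolding ratfun_q_power to_fract_1[symmetric] to_fract_diff[symmetric] by (simp add: one_pCons)
    finally show ?thesis .
  qed
  show ?thesis
  proof (cases "k \<ge> 0")
    case True
    then obtain m where "k = int m" using nonneg_int_cases by blast
    thus ?thesis using nat k by simp
  next
    case False
    hence "k = - int (nat (- k))" by simp
    then obtain m where m: "k = - int m" by blast
    have "1 - ratfun_q powi k = - ((1 - ratfun_q ^ m) / ratfun_q ^ m)"
      by (simp add: m power_int_minus field_simps)
    also have "\<dots> \<in> loc_ideal [:cyclotomic n:] 1"
      using nat k n m by (intro loc_ideal_uminus loc_ideal_divide loc_units_power ratfun_q_unit) auto
    finally show ?thesis .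
  qed
qed

lemma ratfun_a_unit: "n > 0 \<Longrightarrow> ratfun_a \<in> loc_units [:cyclotomic n:]"
proof -
  assume n: "n > 0"
  have "coprime [:cyclotomic n:] [:0, 1:]"
  proof (rule coprime_const_poly[OF cyclotomic_nonzero[OF n]])
    fix c :: "int poly" assume c: "\<And>i. c dvd coeff [:0, 1:] i"
    show "is_unit c" using c[of 1] by simp
  qed
  thus ?thesis unfolding ratfun_a_def by (intro loc_units_to_fract) auto
qed

text \<open>As polynomials in a, both 1 - a q^m and a - q^m have a coefficient 1, so no nonunit that
  is constant in a divides them.\<close>

lemma one_minus_a_q_power_unit:
  assumes n: "n > 0"
  shows "1 - ratfun_a * ratfun_q ^ m \<in> loc_units [:cyclotomic n:]"
    "1 - ratfun_q ^ m / ratfun_a \<in> loc_units [:cyclotomic n:]"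
proof -
  have "coprime [:cyclotomic n:] [:1, - monom 1 m:]"
  proof (rule coprime_const_poly[OF cyclotomic_nonzero[OF n]])
    fix c :: "int poly" assume c: "\<And>i. c dvd coeff [:1, - monom 1 m:] i"
    show "is_unit c" using c[of 0] by simp
  qed
  hence "to_fract [:1, - monom 1 m:] \<in> loc_units [:cyclotomic n:]"
    by (intro loc_units_to_fract) auto
  also have "to_fract [:1, - monom 1 m:] = 1 - ratfun_a * ratfun_q ^ m"
    unfolding ratfun_q_power ratfun_a_def to_fract_1[symmetric] to_fract_mult[symmetric] to_fract_diff[symmetric]
    by (simp add: one_pCons)
  finally show "1 - ratfun_a * ratfun_q ^ m \<in> loc_units [:cyclotomic n:]" .
  have "coprime [:cyclotomic n:] [:- monom 1 m, 1:]"
  proof (rule coprime_const_poly[OF cyclotomic_nonzero[OF n]])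
    fix c :: "int poly" assume c: "\<And>i. c dvd coeff [:- monom 1 m, 1:] i"
    show "is_unit c" using c[of 1] by simp
  qed
  hence "to_fract [:- monom 1 m, 1:] / ratfun_a \<in> loc_units [:cyclotomic n:]"
    by (intro loc_units_divide ratfun_a_unit n loc_units_to_fract) auto
  also have "to_fract [:- monom 1 m, 1:] = ratfun_a - ratfun_q ^ m"
    unfolding ratfun_q_power ratfun_a_def to_fract_diff[symmetric] by simp
  finally show "1 - ratfun_q ^ m / ratfun_a \<in> loc_units [:cyclotomic n:]"
    by (simp add: diff_divide_distrib)
qed

text \<open>Parameters without a are integer powers of q, possibly negative ones such as p/x. With
  every factor in the form 1 - q^e, units and multiples of the cyclotomic polynomial are told apart
  by whether n divides e.\<close>

lemma qpoch_powi: "qpoch (ratfun_q powi r) (ratfun_q ^ d) k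
    = (\<Prod>i<k. 1 - ratfun_q powi (r + int d * int i))"
proof -
  have "ratfun_q powi (r + int d * int i) = ratfun_q powi r * (ratfun_q ^ d) ^ i" for i
  proof -
    have "ratfun_q powi (r + int (d * i)) = ratfun_q powi r * ratfun_q powi int (d * i)"
      by (rule power_int_add) simp
    thus ?thesis unfolding power_int_of_nat power_mult by simp
  qed
  thus ?thesis by (simp add: qpoch_def)
qed

lemma qpoch_powi_unit:
  assumes "n > 0" "\<And>i. i < k \<Longrightarrow> \<not> int n dvd r + int d * int i"
  shows "qpoch (ratfun_q powi r) (ratfun_q ^ d) k \<in> loc_units [:cyclotomic n:]"
  unfolding qpoch_powi
  by (rule loc_units_prod, rule one_minus_ratfun_q_powi_unit[OF assms]) simp

lemma qpoch_powi_ideal: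
  assumes "n > 0" "i < k" "int n dvd r + int d * int i"
  shows "qpoch (ratfun_q powi r) (ratfun_q ^ d) k \<in> loc_ideal [:cyclotomic n:] 1"
proof -
  have int: "1 - ratfun_q powi r' \<in> loc_ideal [:cyclotomic n:] 0" for r'
    by (rule loc_ideal_diff[OF loc_ideal_1 loc_units_in_ideal[OF ratfun_q_powi_unit[OF assms(1)]]])
  show ?thesis
    unfolding qpoch_powi
    by (rule loc_ideal_prod_1[of "{..<k}" i])
      (use assms in \<open>simp_all only: int one_minus_ratfun_q_powi_ideal finite_lessThan lessThan_iff\<close>)
qed

lemma one_minus_mult_power_integral:
  assumes "x \<in> loc_ideal P 0" "p \<in> loc_ideal P 0"
  shows "1 - x * p ^ j \<in> loc_ideal P 0"
  by (rule loc_ideal_diff[OF loc_ideal_1 loc_ideal_mult_left[OF assms(1) loc_ideal_power[OF assms(2)]]])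

lemma qpoch_integral:
  assumes "x \<in> loc_ideal P 0" "p \<in> loc_ideal P 0"
  shows "qpoch x p k \<in> loc_ideal P 0"
  unfolding qpoch_def by (rule loc_ideal_prod, rule one_minus_mult_power_integral[OF assms])

text \<open>The deviation is quadratic in \<open>1 - x\<close> because the product is symmetric under \<open>x \<mapsto> 1 / x\<close>.\<close>

lemma qpoch_pair_cong:
  assumes y: "y \<in> loc_ideal P 0" and p: "p \<in> loc_ideal P 0"
    and x: "x \<in> loc_units P" "1 - x \<in> loc_ideal P 1"
  shows "qpoch y p k ^ 2 - qpoch (y * x) p k * qpoch (y / x) p k \<in> loc_ideal P 2"
proof -
  have x0: "x \<noteq> 0" using x(1) by (rule loc_units_nonzero)
  have yx: "y * x \<in> loc_ideal P 0" "y / x \<in> loc_ideal P 0"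
    using loc_ideal_mult_left[OF y loc_units_in_ideal[OF x(1)]] loc_ideal_divide[OF y x(1)] by auto
  have w: "z * p ^ j \<in> loc_ideal P 0" if "z \<in> loc_ideal P 0" for z j
    using that loc_ideal_power[OF p] by (rule loc_ideal_mult_left)
  note f = one_minus_mult_power_integral[OF _ p]
  have "(\<Prod>j<k. (1 - y * p ^ j) ^ 2) - (\<Prod>j<k. (1 - y * x * p ^ j) * (1 - y / x * p ^ j)) \<in> loc_ideal P 2"
  proof (rule loc_ideal_prod_diff)
    fix j
    show "(1 - y * p ^ j) ^ 2 \<in> loc_ideal P 0"
      by (rule loc_ideal_power[OF f[OF y]])
    show "(1 - y * x * p ^ j) * (1 - y / x * p ^ j) \<in> loc_ideal P 0"
      by (rule loc_ideal_mult_left[OF f[OF yx(1)] f[OF yx(2)]])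
    have "(1 - v) ^ 2 - (1 - v * x) * (1 - v / x) = v * ((1 - x) * (1 - x)) / x" for v
      using x0 by (simp add: field_simps power2_eq_square)
    from this[of "y * p ^ j"]
    have "(1 - y * p ^ j) ^ 2 - (1 - y * x * p ^ j) * (1 - y / x * p ^ j)
        = y * p ^ j * ((1 - x) * (1 - x)) / x"
      by (simp add: mult_ac)
    also have "\<dots> \<in> loc_ideal P 2"
      using loc_ideal_divide[OF loc_ideal_mult_left[OF w[OF y] loc_ideal_mult[OF x(2) x(2)]] x(1)]
      by (simp add: numeral_2_eq_2)
    finally show "(1 - y * p ^ j) ^ 2 - (1 - y * x * p ^ j) * (1 - y / x * p ^ j) \<in> loc_ideal P 2" .
  qed
  thus ?thesis by (simp add: qpoch_def prod_power_distrib prod.distrib)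
qed

subsection \<open>The congruences\<close>

lemma one_minus_q_times_q_int: "(1 - q) * q_int q m = 1 - q ^ m"
  by (simp add: q_int_def one_diff_power_eq)

text \<open>The exponents are d (i + 1) modulo n with 0 < i + 1 < n, and d is invertible modulo n.
  The values s = 0, t, -t give the denominators with p, px and p/x.\<close>

lemma qpoch_powi_unit':
  assumes "n > 0" "coprime n d" "k < n"
  shows "qpoch (ratfun_q powi (int d + s * int n)) (ratfun_q ^ d) k \<in> loc_units [:cyclotomic n:]"
proof (rule qpoch_powi_unit[OF assms(1)])
  fix i assume i: "i < k"
  show "\<not> int n dvd int d + s * int n + int d * int i"
  proof
    assume "int n dvd int d + s * int n + int d * int i"
    also have "int d + s * int n + int d * int i = int (d * Suc i) + s * int n"
      by (simp add: algebra_simps)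
    finally have "int n dvd int (d * Suc i)" by (simp only: dvd_add_times_triv_right_iff)
    hence "n dvd d * Suc i" by (simp only: of_nat_dvd_iff)
    hence "n dvd Suc i" using assms(2) by (simp only: coprime_dvd_mult_right_iff)
    thus False using i assms(3) by (auto dest: dvd_imp_le)
  qed
qed

lemma qpoch_a_unit:
  assumes "n > 0" "d > 0"
  shows "qpoch (ratfun_a * ratfun_q ^ d) (ratfun_q ^ d) k \<in> loc_units [:cyclotomic n:]"
    "qpoch (ratfun_q ^ d / ratfun_a) (ratfun_q ^ d) k \<in> loc_units [:cyclotomic n:]"
proof -
  have "1 - ratfun_a * ratfun_q ^ d * (ratfun_q ^ d) ^ i \<in> loc_units [:cyclotomic n:]"
    "1 - ratfun_q ^ d / ratfun_a * (ratfun_q ^ d) ^ i \<in> loc_units [:cyclotomic n:]" for i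
    using one_minus_a_q_power_unit[OF assms(1), of "d + d * i"]
    by (simp_all add: power_add power_mult mult.assoc)
  thus "qpoch (ratfun_a * ratfun_q ^ d) (ratfun_q ^ d) k \<in> loc_units [:cyclotomic n:]"
    "qpoch (ratfun_q ^ d / ratfun_a) (ratfun_q ^ d) k \<in> loc_units [:cyclotomic n:]"
    unfolding qpoch_def by (auto intro: loc_units_prod)
qed

section \<open>The deformed sum, for both residue classes at once\<close>

context
  fixes n d N t :: nat and q a p x :: "int poly poly fract" and P :: "int poly poly"
  assumes n: "n > 1" and d: "d \<ge> 3"
    and tn: "1 + d * N = t * n" and N: "N < n"
  defines "q \<equiv> ratfun_q" and "a \<equiv> ratfun_a" and "p \<equiv> ratfun_q ^ d"
    and "x \<equiv> ratfun_q ^ (t * n)" and "P \<equiv> [:cyclotomic n:]"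
begin

text \<open>The j-th term on the right of \<open>watson\<close> for A = q, b = aq, c = q/a, d = q, e
  = qx, f = p/q, g = p/(qx), where the parameter d of \<open>watson\<close> is meant. The three
  factors that can be divisible by P stand in front.\<close>

private definition watson_rhs :: "nat \<Rightarrow> int poly poly fract" where
  "watson_rhs j = qpoch q p (Suc N) * qpoch (p / q) p j * qpoch (p / (q * x)) p (N - j)
     * qpoch q p j * qpoch (q * x) p j * qpoch (q / x) p j * qpoch (inverse p ^ j) p j
     * (p / (q * x) * p ^ Suc N) ^ j
   / (qpoch p p j ^ 2 * qpoch (p / a) p j * qpoch (a * p) p j * qpoch p p N * qpoch (p / x) p N)"

private lemma n0: "n > 0" using n by simp

private lemma cop: "coprime n d"
proof (rule coprimeI)
  fix c assume c: "c dvd n" "c dvd d"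
  have "c dvd 1 + d * N" unfolding tn using c(1) by simp
  moreover have "c dvd d * N" using c(2) by simp
  ultimately show "c dvd 1" using dvd_add_left_iff[of c "d * N" 1] by blast
qed

private lemma nonzero: "q \<noteq> 0" "a \<noteq> 0" "p \<noteq> 0" "x \<noteq> 0"
  by (simp_all add: q_def a_def p_def x_def)

private lemma x_eq: "x = q * p ^ N"
  using arg_cong[OF tn, of "\<lambda>m. ratfun_q ^ m"] by (simp add: q_def p_def x_def power_mult)

private lemma powi_eqs:
  "q = ratfun_q powi 1" "p = ratfun_q powi int d" "x = ratfun_q powi (int t * int n)"
  "p / q = ratfun_q powi (int d - 1)" "p / (q * x) = ratfun_q powi (int d - 1 - int t * int n)"
  "p * x = ratfun_q powi (int d + int t * int n)" "p / x = ratfun_q powi (int d + (- int t) * int n)"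
proof -
  show 1: "q = ratfun_q powi 1" "p = ratfun_q powi int d" "x = ratfun_q powi (int t * int n)"
    by (simp_all add: q_def p_def x_def flip: of_nat_mult)
  show "p / q = ratfun_q powi (int d - 1)" "p / (q * x) = ratfun_q powi (int d - 1 - int t * int n)"
    "p * x = ratfun_q powi (int d + int t * int n)" "p / x = ratfun_q powi (int d + (- int t) * int n)"
    unfolding 1 by (simp_all add: power_int_diff power_int_add power_int_minus divide_inverse mult_ac)
qed

private lemma units: "q \<in> loc_units P" "a \<in> loc_units P" "p \<in> loc_units P" "x \<in> loc_units P"
  unfolding q_def a_def p_def x_def P_def
  by (intro ratfun_q_unit ratfun_a_unit loc_units_power n0)+

private lemma qpoch_units:
  "k < n \<Longrightarrow> qpoch p p k \<in> loc_units P"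
  "k < n \<Longrightarrow> qpoch (p * x) p k \<in> loc_units P"
  "k < n \<Longrightarrow> qpoch (p / x) p k \<in> loc_units P"
  "qpoch (a * p) p k \<in> loc_units P"
  "qpoch (p / a) p k \<in> loc_units P"
  using qpoch_powi_unit'[OF n0 cop, of k 0] qpoch_powi_unit'[OF n0 cop, of k "int t"]
    qpoch_powi_unit'[OF n0 cop, of k "- int t"] qpoch_a_unit[OF n0, of d k] d
  unfolding P_def powi_eqs(6,7) by (simp_all add: p_def a_def)

text \<open>Only the three leading factors matter: the other numerator factors are integral, and the
  denominators are units because j and N are below n.\<close>

private lemma watson_rhs_ideal:
  assumes "j \<le> N" and "qpoch q p (Suc N) * qpoch (p / q) p j * qpoch (p / (q * x)) p (N - j) \<in> loc_ideal P m"
  shows "watson_rhs j \<in> loc_ideal P m"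
proof -
  note u = loc_units_in_ideal
  note pI = u[OF units(3)]
  have r: "y * qpoch z p k \<in> loc_ideal P m" if "y \<in> loc_ideal P m" "z \<in> loc_units P" for y z k
    using that(1) qpoch_integral[OF u[OF that(2)] pI] by (rule loc_ideal_mult_right)
  have num: "qpoch q p (Suc N) * qpoch (p / q) p j * qpoch (p / (q * x)) p (N - j)
     * qpoch q p j * qpoch (q * x) p j * qpoch (q / x) p j * qpoch (inverse p ^ j) p j
     * (p / (q * x) * p ^ Suc N) ^ j \<in> loc_ideal P m"
    by (rule loc_ideal_mult_right, rule r, rule r, rule r, rule r, rule assms(2),
        (intro units loc_units_mult loc_units_divide loc_units_power loc_units_inverse u)+)
  have jN: "j < n" "N < n" using assms N by auto
  show ?thesis unfolding watson_rhs_def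
    by (rule loc_ideal_divide[OF num]) (intro loc_units_mult loc_units_power qpoch_units jN)
qed

private lemma watson_lhs:
  "(\<Sum>k\<le>N. (1 - q * p ^ (2 * k)) * qpoch q p k ^ 2 * qpoch (a * q) p k * qpoch (q / a) p k
      * (q ^ (2 * d - 3)) ^ k / (qpoch p p k ^ 2 * qpoch (a * p) p k * qpoch (p / a) p k)
      * (qpoch (q * x) p k * qpoch (q / x) p k / (qpoch (p * x) p k * qpoch (p / x) p k)))
    = (\<Sum>j\<le>N. watson_rhs j)"
proof -
  have e: "p / q * (q / a) = p / a" "p / q * (a * q) = a * p" "p / (q * x) * (q * x) = p"
      "p / (q * x) * q = p / x" "q * p ^ Suc N = p * x" "inverse p ^ N = q / x"
    using nonzero by (simp_all add: x_eq power_inverse field_simps)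
  \<comment> \<open>With x = q p^N the argument f g p^N becomes p^2/q^3, which is the power q^(2d -
    3) of the theorem.\<close>
  have z: "p / q * (p / (q * x)) * p ^ N = q ^ (2 * d - 3)"
  proof -
    have "2 * d - 3 + 3 = d + d" using d by simp
    hence "q ^ (2 * d - 3) * q ^ 3 = p * p"
      unfolding p_def q_def power_add[symmetric] by (rule arg_cong)
    moreover have "p / q * (p / (q * x)) * p ^ N = p * p / q ^ 3"
      using nonzero by (simp add: x_eq power3_eq_cube)
    ultimately show ?thesis using nonzero(1) by (metis nonzero_mult_div_cancel_right power_not_zero)
  qed
  have ne: "ratfun_q powi k \<noteq> 1" if "k \<noteq> 0" for k
    using that by (simp add: ratfun_q_powi_eq_1_iff)
  have pos: "ratfun_q powi k \<noteq> 1" if "k > 0" for k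
    using that by (intro ne) simp
  have sh: "ratfun_q powi r * p ^ i = ratfun_q powi (r + int (d * i))" for r i
  proof -
    have "ratfun_q powi (r + int (d * i)) = ratfun_q powi r * ratfun_q powi int (d * i)"
      by (rule power_int_add) simp
    thus ?thesis by (simp only: power_int_of_nat p_def power_mult)
  qed
  have "(\<Sum>k\<le>N. (1 - q * p ^ (2 * k)) * qpoch q p k * qpoch (a * q) p k * qpoch (q / a) p k
        * qpoch q p k * qpoch (q * x) p k * qpoch (inverse p ^ N) p k * (p / q * (p / (q * x)) * p ^ N) ^ k
      / (qpoch p p k * qpoch (p / q * (q / a)) p k * qpoch (p / q * (a * q)) p k
        * qpoch (p / (q * x) * (q * x)) p k * qpoch (p / (q * x) * q) p k * qpoch (q * p ^ Suc N) p k))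
    = (\<Sum>j\<le>N. qpoch q p (Suc N) * qpoch (p / q) p j * qpoch (p / (q * x)) p (N - j) * qpoch q p j * qpoch (q * x) p j
        * qpoch (inverse p ^ N) p j * qpoch (inverse p ^ j) p j * (p / (q * x) * p ^ Suc N) ^ j
      / (qpoch p p j ^ 2 * qpoch (p / q * (q / a)) p j * qpoch (p / q * (a * q)) p j
        * qpoch (p / (q * x) * (q * x)) p N * qpoch (p / (q * x) * q) p N))"
  proof (rule watson)
    show "p \<noteq> 0" "q * p = p / q * (a * q) * (q / a)" "q * p = p / (q * x) * q * (q * x)"
      using nonzero by simp_all
    show "p * p ^ i \<noteq> 1" for i
    proof -
      have "p * p ^ i = ratfun_q powi int d * p ^ i" by (simp add: p_def)
      also have "\<dots> \<noteq> 1" unfolding sh by (rule pos, rule add_pos_nonneg) (use d in simp_all)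
      finally show ?thesis .
    qed
    thus "p / (q * x) * (q * x) * p ^ i \<noteq> 1" for i unfolding e .
    have "1 - a * p * p ^ i \<noteq> 0" "1 - p / a * p ^ i \<noteq> 0" for i
      using one_minus_a_q_power_unit[OF n0, of "d + d * i", THEN loc_units_nonzero]
      by (simp_all add: p_def a_def power_add power_mult mult.assoc)
    thus "p / q * (q / a) * p ^ i \<noteq> 1" "p / q * (a * q) * p ^ i \<noteq> 1" for i
      unfolding e by auto
    show "q * p * p ^ i \<noteq> 1" for i
    proof -
      have "q * p * p ^ i = ratfun_q powi 1 * p ^ Suc i" by (simp add: q_def mult.assoc)
      also have "\<dots> \<noteq> 1" unfolding sh by (rule pos, rule add_pos_nonneg) simp_all
      finally show ?thesis .
    qed
    \<comment> \<open>This exponent may be negative, so positivity is no argument here; it is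
      nonzero because it is -1 modulo d.\<close>
    show "p / (q * x) * q * p ^ i \<noteq> 1" for i
      unfolding e powi_eqs(7) sh
    proof (intro ne notI)
      assume "int d + - int t * int n + int (d * i) = 0"
      hence "int (d * Suc i) = int (t * n)" by (simp add: algebra_simps)
      hence "d * Suc i = 1 + d * N" unfolding tn of_nat_eq_iff .
      hence "d dvd 1 + d * N" using dvd_triv_left[of d "Suc i"] by (simp only:)
      hence "d dvd 1" using dvd_add_left_iff[of d "d * N" 1] by simp
      thus False using d by simp
    qed
  qed
  thus ?thesis unfolding e z watson_rhs_def
    by (simp add: power2_eq_square mult_ac)
qed

text \<open>Each term is \<open>F k * r k\<close> with \<open>F k\<close> integral, and only the
  ratio \<open>r k\<close> is deformed, to \<open>r' k\<close>. For k < n all denominators involved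
  are units, so the quadratic estimate \<open>qpoch_pair_cong\<close> passes to the quotients and to
  the sum.\<close>

lemma sum_cong_watson_rhs:
  "(1 - q) * (\<Sum>k<n. q_int q (2 * d * k + 1)
      * ((qpochs [a * q, q / a] (q ^ d) k * qpoch q (q ^ d) k ^ 4)
         / (qpochs [a * q ^ d, q ^ d / a] (q ^ d) k * qpoch (q ^ d) (q ^ d) k ^ 4))
      * q ^ ((2 * d - 3) * k)) - (\<Sum>j\<le>N. watson_rhs j) \<in> loc_ideal P 2"
proof -
  define F where "F k = (1 - q * p ^ (2 * k)) * qpoch q p k ^ 2 * qpoch (a * q) p k * qpoch (q / a) p k
      * (q ^ (2 * d - 3)) ^ k / (qpoch p p k ^ 2 * qpoch (a * p) p k * qpoch (p / a) p k)" for k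
  define r where "r k = qpoch q p k ^ 2 / qpoch p p k ^ 2" for k
  define r' where "r' k = qpoch (q * x) p k * qpoch (q / x) p k / (qpoch (p * x) p k * qpoch (p / x) p k)" for k
  have qp: "q ^ d = p" by (simp add: q_def p_def)
  note I = units[THEN loc_units_in_ideal]
  have F: "F k \<in> loc_ideal P 0" if "k < n" for k
    unfolding F_def using that
    by (intro loc_ideal_divide loc_ideal_mult_left loc_ideal_power loc_ideal_diff loc_ideal_1 I
        loc_units_mult loc_units_power qpoch_units qpoch_integral loc_units_in_ideal[OF loc_units_divide[OF units(1,2)]])
  have x1: "1 - x \<in> loc_ideal P 1"
    unfolding P_def powi_eqs(3) by (rule one_minus_ratfun_q_powi_ideal[OF n0]) simp
  have rr: "r k - r' k \<in> loc_ideal P 2" if k: "k < n" for k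
    unfolding r_def r'_def
  proof (rule loc_ideal_divide_diff)
    show "(qpoch q p k)\<^sup>2 \<in> loc_ideal P 0" by (intro loc_ideal_power qpoch_integral I)
    show "(qpoch p p k)\<^sup>2 \<in> loc_units P" "qpoch (p * x) p k * qpoch (p / x) p k \<in> loc_units P"
      using k by (intro loc_units_power loc_units_mult qpoch_units; simp)+
    show "(qpoch q p k)\<^sup>2 - qpoch (q * x) p k * qpoch (q / x) p k \<in> loc_ideal P 2"
      by (rule qpoch_pair_cong[OF I(1) I(3) units(4) x1])
    show "(qpoch p p k)\<^sup>2 - qpoch (p * x) p k * qpoch (p / x) p k \<in> loc_ideal P 2"
      by (rule qpoch_pair_cong[OF I(3) I(3) units(4) x1])
  qed
  have "(1 - q) * (\<Sum>k<n. q_int q (2 * d * k + 1)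
      * ((qpochs [a * q, q / a] (q ^ d) k * qpoch q (q ^ d) k ^ 4)
         / (qpochs [a * q ^ d, q ^ d / a] (q ^ d) k * qpoch (q ^ d) (q ^ d) k ^ 4))
      * q ^ ((2 * d - 3) * k)) = (\<Sum>k<n. F k * r k)"
    unfolding sum_distrib_left
  proof (intro sum.cong refl)
    fix k
    have "1 - q * p ^ (2 * k) = (1 - q) * q_int q (2 * d * k + 1)"
      unfolding one_minus_q_times_q_int by (simp add: p_def q_def power_mult[symmetric] mult_ac)
    moreover have "y ^ 4 = y ^ 2 * y ^ 2" for y :: "int poly poly fract"
      by (simp flip: power_add)
    ultimately show "(1 - q) * (q_int q (2 * d * k + 1)
      * ((qpochs [a * q, q / a] (q ^ d) k * qpoch q (q ^ d) k ^ 4)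
         / (qpochs [a * q ^ d, q ^ d / a] (q ^ d) k * qpoch (q ^ d) (q ^ d) k ^ 4))
      * q ^ ((2 * d - 3) * k)) = F k * r k"
      unfolding F_def r_def qp qpochs_def power_mult by (simp add: mult_ac)
  qed
  moreover have "(\<Sum>k<n. F k * r' k) = (\<Sum>j\<le>N. watson_rhs j)"
  proof -
    \<comment> \<open>The deformed sum stops at N, so extending it to all k < n adds only
      zeros.\<close>
    have "r' k = 0" if "N < k" for k
    proof -
      have "q / x = inverse p ^ N" using nonzero by (simp add: x_eq power_inverse field_simps)
      thus ?thesis using qpoch_inverse_power_eq_0[OF nonzero(3) that] by (simp add: r'_def)
    qed
    hence "(\<Sum>k<n. F k * r' k) = (\<Sum>k\<le>N. F k * r' k)"
      using N by (intro sum.mono_neutral_right) auto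
    thus ?thesis using watson_lhs unfolding F_def r'_def by simp
  qed
  moreover have "(\<Sum>k<n. F k * r k) - (\<Sum>k<n. F k * r' k) = (\<Sum>k<n. F k * (r k - r' k))"
    by (simp only: sum_subtractf right_diff_distrib)
  moreover have "\<dots> \<in> loc_ideal P 2"
    by (intro loc_ideal_sum loc_ideal_mult_left F rr) auto
  ultimately show ?thesis by simp
qed

text \<open>The bound m \<le> 2 is the precision of the deformation: beyond it, the right-hand side
  of Watson's formula says nothing about the original sum.\<close>

lemma ratfun_cong_if_watson_rhs:
  assumes m: "m \<le> 2"
    and rhs: "\<And>j. j \<le> N \<Longrightarrow>
      qpoch q p (Suc N) * qpoch (p / q) p j * qpoch (p / (q * x)) p (N - j) \<in> loc_ideal P m"
  shows "ratfun_cong (\<Sum>k = 0..n - 1. q_int q (2 * d * k + 1)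
      * ((qpochs [a * q, q / a] (q ^ d) k * qpoch q (q ^ d) k ^ 4)
         / (qpochs [a * q ^ d, q ^ d / a] (q ^ d) k * qpoch (q ^ d) (q ^ d) k ^ 4))
      * q ^ ((2 * d - 3) * k)) 0 (P ^ m)"
proof -
  have *: "{0..n - 1} = {..<n}" using n by auto
  define S where "S = (\<Sum>k<n. q_int q (2 * d * k + 1)
      * ((qpochs [a * q, q / a] (q ^ d) k * qpoch q (q ^ d) k ^ 4)
         / (qpochs [a * q ^ d, q ^ d / a] (q ^ d) k * qpoch (q ^ d) (q ^ d) k ^ 4))
      * q ^ ((2 * d - 3) * k))"
  have "(1 - q) * S - (\<Sum>j\<le>N. watson_rhs j) \<in> loc_ideal P m"
    using sum_cong_watson_rhs m unfolding S_def by (rule loc_ideal_antimono)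
  moreover have "(\<Sum>j\<le>N. watson_rhs j) \<in> loc_ideal P m"
    by (rule loc_ideal_sum, rule watson_rhs_ideal) (use rhs in auto)
  ultimately have "(1 - q) * S \<in> loc_ideal P m"
    using loc_ideal_add by fastforce
  moreover have u: "1 - q \<in> loc_units P"
    unfolding P_def powi_eqs(1) by (rule one_minus_ratfun_q_powi_unit[OF n0]) (use n in simp)
  ultimately have "(1 - q) * S / (1 - q) \<in> loc_ideal P m"
    by (rule loc_ideal_divide)
  hence "S \<in> loc_ideal P m" using loc_units_nonzero[OF u] by simp
  thus ?thesis unfolding * ratfun_cong_def S_def[symmetric] using loc_ideal_imp_dvd by simp
qed

section \<open>Factors divisible by the cyclotomic polynomial\<close>

lemma leading_factor_ideal: "qpoch q p (Suc N) \<in> loc_ideal P 1"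
  unfolding P_def powi_eqs(1) unfolding p_def
proof (rule qpoch_powi_ideal[OF n0, of N])
  have "1 + int d * int N = int (t * n)" unfolding tn[symmetric] by simp
  thus "int n dvd 1 + int d * int N" by simp
qed simp

lemma qpoch_integrals:
  "qpoch (p / q) p k \<in> loc_ideal P 0" "qpoch (p / (q * x)) p k \<in> loc_ideal P 0"
  by (intro qpoch_integral loc_units_in_ideal loc_units_divide loc_units_mult units)+

lemma second_factor_ideal:
  assumes M: "n + 1 = d * M"
  shows "M \<le> k \<Longrightarrow> qpoch (p / q) p k \<in> loc_ideal P 1"
    "M \<le> k \<Longrightarrow> qpoch (p / (q * x)) p k \<in> loc_ideal P 1"
proof -
  assume k: "M \<le> k"
  have M0: "M > 0" using M by (cases M) auto
  \<comment> \<open>The factor of index i of (p/q;p)_k has exponent d (i + 1) - 1, which equals n at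
    i = M - 1; this is why k \<ge> M suffices. The other product has all exponents lowered by t
    n.\<close>
  have "d + d * (M - 1) = n + 1" unfolding M using M0 by (cases M) auto
  hence "int (d + d * (M - 1)) = int (n + 1)" by (simp only:)
  hence e: "int d + int d * int (M - 1) = int n + 1" by (simp only: of_nat_add of_nat_mult of_nat_1)
  show "qpoch (p / q) p k \<in> loc_ideal P 1"
    unfolding P_def powi_eqs(4) unfolding p_def
  proof (rule qpoch_powi_ideal[OF n0, of "M - 1"])
    have "int d - 1 + int d * int (M - 1) = int n" using e by simp
    thus "int n dvd int d - 1 + int d * int (M - 1)" by simp
  qed (use k M0 in simp)
  show "qpoch (p / (q * x)) p k \<in> loc_ideal P 1"
    unfolding P_def powi_eqs(5) unfolding p_def
  proof (rule qpoch_powi_ideal[OF n0, of "M - 1"])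
    have *: "int d - 1 - int t * int n + int d * int (M - 1) = int n - int t * int n" using e by linarith
    show "int n dvd int d - 1 - int t * int n + int d * int (M - 1)" unfolding * by simp
  qed (use k M0 in simp)
qed

end

theorem theorem4p1:
  fixes n d :: nat and q a :: "int poly poly fract" and S :: "int poly poly fract"
  defines "q \<equiv> ratfun_q" and "a \<equiv> ratfun_a"
  defines "S \<equiv> (\<Sum>k = 0..n - 1.
      q_int q (2 * d * k + 1)
      * ((qpochs [a * q, q / a] (q ^ d) k * qpoch q (q ^ d) k ^ 4)
         / (qpochs [a * q ^ d, q ^ d / a] (q ^ d) k * qpoch (q ^ d) (q ^ d) k ^ 4))
      * q ^ ((2 * d - 3) * k))"
  assumes "n > 1" and "d \<ge> 3"
    and "[int n = 1] (mod int d) \<or> [int n = - 1] (mod int d)"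
  shows "([int n = 1] (mod int d) \<longrightarrow> ratfun_cong S 0 [:cyclotomic n:])
    \<and> ([int n = - 1] (mod int d) \<longrightarrow> ratfun_cong S 0 ([:cyclotomic n:] ^ 2))"
proof (intro conjI impI)
  assume "[int n = 1] (mod int d)"
  hence "int d dvd int (n - 1)" using assms(4) by (simp add: cong_iff_dvd_diff of_nat_diff)
  then obtain N where "n - 1 = d * N" by (auto simp: of_nat_dvd_iff)
  hence N: "1 + d * N = 1 * n" using assms(4) by simp
  have "N \<le> d * N" using assms(5) by simp
  hence lt: "N < n" using N by linarith
  note ctx = assms(4,5) N lt
  \<comment> \<open>Here t = 1, and the leading factor alone supplies the divisibility; the other
    two enter only as integral elements.\<close>
  have "ratfun_cong S 0 ([:cyclotomic n:] ^ 1)"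
    unfolding S_def q_def a_def
    by (rule ratfun_cong_if_watson_rhs[OF ctx])
      (auto intro!: loc_ideal_mult_right leading_factor_ideal[OF ctx, simplified] qpoch_integrals[OF ctx, simplified])
  thus "ratfun_cong S 0 [:cyclotomic n:]" by simp
next
  assume "[int n = - 1] (mod int d)"
  hence "int d dvd int (n + 1)" by (simp add: cong_iff_dvd_diff add.commute)
  then obtain M where M: "n + 1 = d * M" by (auto simp only: of_nat_dvd_iff elim: dvdE)
  have M0: "M > 0" using M by (cases M) auto
  have "3 * M \<le> d * M" using assms(5) by simp
  hence M3: "3 * M \<le> n + 1" unfolding M .
  \<comment> \<open>From n + 1 = d M one gets (d - 1) n - 1 = d n - d M = d (n - M).\<close>
  define N where "N = n - M"
  have N: "1 + d * N = (d - 1) * n"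
  proof -
    have "3 * n \<le> d * n" using assms(5) by simp
    thus ?thesis
      unfolding N_def diff_mult_distrib diff_mult_distrib2 M[symmetric] using \<open>3 * n \<le> d * n\<close> assms(4) by linarith
  qed
  have lt: "N < n" using M0 assms(4) by (simp add: N_def)
  note ctx = assms(4,5) N lt
  show "ratfun_cong S 0 ([:cyclotomic n:] ^ 2)"
    unfolding S_def q_def a_def
  proof (rule ratfun_cong_if_watson_rhs[OF ctx])
    fix j assume j: "j \<le> N"
    note lead = leading_factor_ideal[OF ctx]
    note int = qpoch_integrals[OF ctx]
    note sec = second_factor_ideal[OF ctx M]
    \<comment> \<open>Otherwise j and N - j would both be at most M - 1, so N \<le> 2M - 2, whereas
      3M \<le> n + 1 gives N = n - M \<ge> 2M - 1. The assumption d \<ge> 3 is what provides 3M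
      \<le> n + 1.\<close>
    have "M \<le> j \<or> M \<le> N - j" using j M3 M0 unfolding N_def by arith
    then consider "M \<le> j" | "M \<le> N - j" by blast
    thus "qpoch ratfun_q (ratfun_q ^ d) (Suc N) * qpoch (ratfun_q ^ d / ratfun_q) (ratfun_q ^ d) j
        * qpoch (ratfun_q ^ d / (ratfun_q * ratfun_q ^ ((d - 1) * n))) (ratfun_q ^ d) (N - j)
        \<in> loc_ideal [:cyclotomic n:] 2"
    proof cases
      case 1
      show ?thesis
        using loc_ideal_mult_right[OF loc_ideal_mult[OF lead sec(1)[OF 1]] int(2)] by (simp add: numeral_2_eq_2)
    next
      case 2
      show ?thesis
        using loc_ideal_mult[OF loc_ideal_mult_right[OF lead int(1)] sec(2)[OF 2]] by (simp add: numeral_2_eq_2)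
    qed
  qed simp
qed

end
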